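(* Let $\beta=0$. Let $\boldsymbol{b}$ be a braid on $k\ge1$ strands whose closure is a link $K$, let $1\le j\le k$, and let $\tilde{\boldsymbol{b}}$ denote the closure of all strands of $\boldsymbol{b}$ except the $j$-th one. Then the image of $\tilde{\boldsymbol{b}}$ in $\mathrm{End}_{\dot{\mathbf U}_q(\mathfrak{gl}_{k+(k-1)})_0}(\mathbf{1}_{(0,\dots,0,1,0,\dots,0,\beta-0,\dots,\beta-0)})$, where the $1$ appears in position $j$ (the position of the open strand), is the Alexander polynomial of $K$; that is, $\tilde{\boldsymbol{b}}=\Delta_K\cdot\mathbf{1}_{(0,\dots,0,1,0,\dots,0,\beta-0,\dots,\beta-0)}$.
   Context: **Doubled Schur algebra.** $\beta$ is an integer or a formal variable; the base field is $\mathbb{C}(q,q^\beta)$ (equal to $\mathbb{C}(q)$ when $\beta\in\mathbb{Z}$). Put $[x]=\frac{q^x-q^{-x}}{q-q^{-1}}$, $\mathbb{N}=\{0,1,2,\dots\}$. For $k,l\ge 0$, let $\mathsf{P}^\beta_{k,l}$ be the set of sequences $\lambda=(\lambda_1,\dots,\lambda_{k+l})$ with $\lambda_i\in\mathbb{N}$ for $i\le k$ and $\lambda_i\in\beta-\mathbb{N}$ for $i\ge k+1$. Let $\alpha_i=(0,\dots,0,1,-1,0,\dots,0)$ with $1$ in position $i$. $\dot{\mathbf U}_q(\mathfrak{gl}_{k+l})_\beta$ is the $\mathbb{C}(q,q^\beta)$-linear category with objects $\mathbf{1}_\lambda$, $\lambda\in\mathsf{P}^\beta_{k,l}$, and a zero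 object; morphisms are generated by the identities $\mathbf{1}_\lambda$ and by $E_i\mathbf{1}_\lambda\in\mathrm{Hom}(\mathbf{1}_\lambda,\mathbf{1}_{\lambda+\alpha_i})$, $F_i\mathbf{1}_\lambda\in\mathrm{Hom}(\mathbf{1}_\lambda,\mathbf{1}_{\lambda-\alpha_i})$, $1\le i\le k+l-1$, subject to: $\mathbf{1}_\lambda\mathbf{1}_{\lambda'}=\delta_{\lambda,\lambda'}\mathbf{1}_\lambda$; $(E_iF_j-F_jE_i)\mathbf{1}_\lambda=\delta_{i,j}[\lambda_i-\lambda_{i+1}]\mathbf{1}_\lambda$; $E_i^2E_j\mathbf{1}_\lambda-(q+q^{-1})E_iE_jE_i\mathbf{1}_\lambda+E_jE_i^2\mathbf{1}_\lambda=0$ and $F_i^2F_j\mathbf{1}_\lambda-(q+q^{-1})F_iF_jF_i\mathbf{1}_\lambda+F_jF_i^2\mathbf{1}_\lambda=0$ for $j=i\pm1$; $E_iE_j\mathbf{1}_\lambda=E_jE_i\mathbf{1}_\lambda$ and $F_iF_j\mathbf{1}_\lambda=F_jF_i\mathbf{1}_\lambda$ for $|i-j|>1$. Any $\mathbf{1}_\mu$ with $\mu\notin\mathsf{P}^\beta_{k,l}$ is the zero object. Products are composed right to left. $\dot{\mathbf U}_q(\mathfrak{gl}_{k+l})_0$ is the case $\beta=0$. **Braids.** Braids are read from bottom to top, strands oriented upward. $\sigma_i$ is the positive crossing of strands $i,i+1$ in which the strand going from bottom-left to top-right passes over; in $\sigma_i^{-1}$ the strand going from bottom-right to top-left passes over.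 Assign $\sigma_i\mapsto q^{-1}-E_iF_i$, $\sigma_i^{-1}\mapsto q-E_iF_i$ on weights with $\lambda_i=\lambda_{i+1}=1$, composing right to left as the braid is read bottom to top; a braid $\boldsymbol{b}$ on $k$ strands thus gives an endomorphism, also denoted $\boldsymbol{b}$, of $\mathbf{1}_{(1^k,(\beta-1)^{k-1})}$ in $\dot{\mathbf U}_q(\mathfrak{gl}_{k+(k-1)})_\beta$. **Closing all strands but one.** In $\dot{\mathbf U}_q(\mathfrak{gl}_{k+(k-1)})_\beta$, for $1\le s\le k-1$ put $D_s=F_k\,(F_{k+1}F_{k+2}\cdots F_{k+s-1})\,(F_{k-1}F_{k-2}\cdots F_{k-s+1})$ and $D_s^*=(E_{k-s+1}\cdots E_{k-1})\,(E_{k+s-1}\cdots E_{k+1})\,E_k$ (empty products are identities). Then $D_{k-1}\cdots D_1:\mathbf{1}_{(1^k,(\beta-1)^{k-1})}\to\mathbf{1}_{(1,0^{k-1},\beta^{k-1})}$ caps off strands $2,\dots,k$ to the right, and $D_1^*\cdots D_{k-1}^*$ is the corresponding system of cups. If the open strand is the first ($j=1$), $\tilde{\boldsymbol{b}}=D_{k-1}\cdots D_1\,\boldsymbol{b}\,D_1^*\cdots D_{k-1}^*$. For general $j$, the arcs closing the strands to the left of the open strand pass over it: with the braid $c=\sigma_{j-1}^{-1}\cdots\sigma_2^{-1}\sigma_1^{-1}$ (product read right to left, moving strand $1$ to position $j$ under the others), $\tilde{\boldsymbol{b}}=(F_{j-1}\cdots F_2F_1)\,D_{k-1}\cdots D_1\,c^{-1}\boldsymbol{b}\,c\,D_1^*\cdots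 D_{k-1}^*\,(E_1E_2\cdots E_{j-1})$, an endomorphism of $\mathbf{1}_\mu$, where $\mu$ has $1$ in position $j$, $0$ in the other first $k$ positions and $\beta$ in the last $k-1$ positions. **Alexander polynomial.** $\Delta$ is the (Conway-normalized) Alexander polynomial of oriented links with $t=q^{-2}$: the link invariant determined by $\Delta(L_+)-\Delta(L_-)=(q^{-1}-q)\Delta(L_0)$ (with $L_\pm$, $L_0$ differing at one crossing: positive, negative, oriented smoothing) and $\Delta(\text{unknot})=1$. *)

theory Defs
  imports
    Complex_Main
    "HOL-Computational_Algebra.Polynomial"
    "HOL-Computational_Algebra.Fraction_Field"
    "HOL-Library.Poly_Mapping"
begin

section \<open>The ground field\<close>

type_synonym qfield = "complex poly fract"

definition q :: qfield
  where "q = Fract [:0, 1:] 1"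

definition qint :: "int \<Rightarrow> qfield"
  where "qint n = (q powi n - q powi (- n)) / (q - inverse q)"


section \<open>The doubled Schur algebra\<close>

text \<open>
  A weight \<open>(\<nu>_1, \<dots>, \<nu>_{k+l})\<close> is a function on all naturals that vanishes outside
  \<open>{1..k+l}\<close>, so that weights correspond exactly to sequences. Here \<open>\<beta>\<close> is an integer;
  the ground field is then \<open>\<complex>(q)\<close>.
\<close>

type_synonym weight = "nat \<Rightarrow> int"

definition weights :: "int \<Rightarrow> nat \<Rightarrow> nat \<Rightarrow> weight set"
  where "weights \<beta> k l = {\<nu>. (\<forall>i\<in>{1..k}. 0 \<le> \<nu> i) \<and> (\<forall>i\<in>{k+1..k+l}. \<nu> i \<le> \<beta>) \<and>
                            (\<forall>i. i \<notin> {1..k+l} \<longrightarrow> \<nu> i = 0)}"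

datatype gen = GenE nat | GenF nat

text \<open>Words are wrapped lists only in order to make them a monoid under concatenation; the
  type \<open>word \<Rightarrow>\<^sub>0 qfield\<close> is then the free algebra on the letters \<open>E_i, F_i\<close>.\<close>

datatype word = Word (letters: "gen list")

instantiation word :: monoid_add
begin

definition "0 = Word []"
definition "u + v = Word (letters u @ letters v)"

instance
  by standard (simp_all add: zero_word_def plus_word_def)

end

type_synonym free_alg = "word \<Rightarrow>\<^sub>0 qfield"

definition E :: "nat \<Rightarrow> free_alg"
  where "E i = Poly_Mapping.single (Word [GenE i]) 1"

definition F :: "nat \<Rightarrow> free_alg"
  where "F i = Poly_Mapping.single (Word [GenF i]) 1"

definition scalar :: "qfield \<Rightarrow> free_alg"
  where "scalar c = Poly_Mapping.single 0 c"

fun shift :: "gen \<Rightarrow> weight \<Rightarrow> weight"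
  where
    "shift (GenE i) \<nu> = \<nu>(i := \<nu> i + 1, Suc i := \<nu> (Suc i) - 1)"
  | "shift (GenF i) \<nu> = \<nu>(i := \<nu> i - 1, Suc i := \<nu> (Suc i) + 1)"

text \<open>Words act from right to left: \<open>w\<close> leads from \<open>1_\<nu>\<close> to \<open>1_{target w \<nu>}\<close>.\<close>

definition target :: "word \<Rightarrow> weight \<Rightarrow> weight"
  where "target w \<nu> = foldr shift (letters w) \<nu>"

text \<open>
  \<open>rel \<beta> k l \<nu> r\<close> says that \<open>r 1_\<nu> = 0\<close> is a defining relation. By the first rule the identity of
  an object that is not a weight vanishes, i.e. such an object is a zero object. This also
  disposes of the letters \<open>E_i, F_i\<close> with \<open>i\<close> outside \<open>{1..k+l-1}\<close>, because they lead from every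
  weight to a sequence that is not supported in \<open>{1..k+l}\<close>.
\<close>

inductive rel :: "int \<Rightarrow> nat \<Rightarrow> nat \<Rightarrow> weight \<Rightarrow> free_alg \<Rightarrow> bool"
  for \<beta> :: int and k l :: nat and \<nu> :: weight
  where
    zero_object: "\<nu> \<notin> weights \<beta> k l \<Longrightarrow> rel \<beta> k l \<nu> 1"
  | commutator: "\<lbrakk>i \<in> {1..<k+l}; j \<in> {1..<k+l}\<rbrakk> \<Longrightarrow>
      rel \<beta> k l \<nu> (E i * F j - F j * E i - (if i = j then scalar (qint (\<nu> i - \<nu> (Suc i))) else 0))"
  | serre_E: "\<lbrakk>i \<in> {1..<k+l}; j \<in> {1..<k+l}; j = Suc i \<or> i = Suc j\<rbrakk> \<Longrightarrow>
      rel \<beta> k l \<nu> (E i * E i * E j - scalar (q + inverse q) * E i * E j * E i + E j * E i * E i)"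
  | serre_F: "\<lbrakk>i \<in> {1..<k+l}; j \<in> {1..<k+l}; j = Suc i \<or> i = Suc j\<rbrakk> \<Longrightarrow>
      rel \<beta> k l \<nu> (F i * F i * F j - scalar (q + inverse q) * F i * F j * F i + F j * F i * F i)"
  | far_E: "\<lbrakk>i \<in> {1..<k+l}; j \<in> {1..<k+l}; Suc i < j \<or> Suc j < i\<rbrakk> \<Longrightarrow>
      rel \<beta> k l \<nu> (E i * E j - E j * E i)"
  | far_F: "\<lbrakk>i \<in> {1..<k+l}; j \<in> {1..<k+l}; Suc i < j \<or> Suc j < i\<rbrakk> \<Longrightarrow>
      rel \<beta> k l \<nu> (F i * F j - F j * F i)"

text \<open>The combinations \<open>x\<close> with \<open>x 1_\<nu> = 0\<close>: the linear span of all \<open>u r v\<close>, where \<open>u, v\<close> are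
  words and \<open>r\<close> is a relation at the weight reached by \<open>v\<close> from \<open>\<nu>\<close>.\<close>

inductive_set null :: "int \<Rightarrow> nat \<Rightarrow> nat \<Rightarrow> weight \<Rightarrow> free_alg set"
  for \<beta> :: int and k l :: nat and \<nu> :: weight
  where
    null_zero: "0 \<in> null \<beta> k l \<nu>"
  | null_add: "\<lbrakk>x \<in> null \<beta> k l \<nu>; y \<in> null \<beta> k l \<nu>\<rbrakk> \<Longrightarrow> x + y \<in> null \<beta> k l \<nu>"
  | null_rel: "rel \<beta> k l (target v \<nu>) r \<Longrightarrow>
      Poly_Mapping.single u c * r * Poly_Mapping.single v 1 \<in> null \<beta> k l \<nu>"

text \<open>
  The morphism \<open>x 1_\<nu>\<close>, as a residue class. Every relation is homogeneous for the target weight;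
  the morphisms from \<open>1_\<nu>\<close> to \<open>1_\<mu>\<close> are the classes of combinations of words leading
  from \<open>\<nu>\<close> to \<open>\<mu>\<close>.
\<close>

definition mor :: "int \<Rightarrow> nat \<Rightarrow> nat \<Rightarrow> weight \<Rightarrow> free_alg \<Rightarrow> free_alg set"
  where "mor \<beta> k l \<nu> x = {y. y - x \<in> null \<beta> k l \<nu>}"

definition Hom :: "int \<Rightarrow> nat \<Rightarrow> nat \<Rightarrow> weight \<Rightarrow> weight \<Rightarrow> free_alg set set"
  where "Hom \<beta> k l \<nu> \<mu> = mor \<beta> k l \<nu> ` {x. \<forall>w \<in> Poly_Mapping.keys x. target w \<nu> = \<mu>}"


section \<open>Braids and their images\<close>

text \<open>
  The letter \<open>(i, True)\<close> is \<open>\<sigma>_i\<close> and \<open>(i, False)\<close> is its inverse. Words are products read from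
  right to left, so the last letter is at the bottom of the braid.
\<close>

type_synonym braid = "(nat \<times> bool) list"

definition is_braid :: "nat \<Rightarrow> braid \<Rightarrow> bool"
  where "is_braid k b \<longleftrightarrow> (\<forall>(i, s) \<in> set b. 1 \<le> i \<and> i < k)"

definition braid_inverse :: "braid \<Rightarrow> braid"
  where "braid_inverse b = rev (map (\<lambda>(i, s). (i, \<not> s)) b)"

definition braid_image :: "braid \<Rightarrow> free_alg"
  where "braid_image b =
    prod_list (map (\<lambda>(i, s). scalar (if s then inverse q else q) - E i * F i) b)"

definition Es :: "nat list \<Rightarrow> free_alg"
  where "Es is = prod_list (map E is)"

definition Fs :: "nat list \<Rightarrow> free_alg"
  where "Fs is = prod_list (map F is)"

definition D :: "nat \<Rightarrow> nat \<Rightarrow> free_alg"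
  where "D k s = F k * Fs [k+1..<k+s] * Fs (rev [k-s+1..<k])"

definition D_star :: "nat \<Rightarrow> nat \<Rightarrow> free_alg"
  where "D_star k s = Es [k-s+1..<k] * Es (rev [k+1..<k+s]) * E k"

definition to_position :: "nat \<Rightarrow> braid"
  where "to_position j = map (\<lambda>i. (i, False)) (rev [1..<j])"

definition open_closure :: "nat \<Rightarrow> nat \<Rightarrow> braid \<Rightarrow> free_alg"
  where "open_closure k j b =
    Fs (rev [1..<j]) * prod_list (map (D k) (rev [1..<k])) *
    braid_image (braid_inverse (to_position j) @ b @ to_position j) *
    prod_list (map (D_star k) [1..<k]) * Es [1..<j]"

definition open_weight :: "int \<Rightarrow> nat \<Rightarrow> nat \<Rightarrow> weight"
  where "open_weight \<beta> k j =
    (\<lambda>i. if i = j then 1 else if i \<in> {k+1..k+(k-1)} then \<beta> else 0)"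


section \<open>Oriented links\<close>

text \<open>
  Oriented link diagrams in Morse position, cut into horizontal slices containing one crossing,
  minimum or maximum each. A slice \<open>(p, e)\<close> has its event at the strands \<open>p, p+1\<close> (counted from
  the left, starting with 1). The topmost slice comes first in the list, as for braid words.
  In \<open>Cross s\<close> the strand joining bottom left to top right is the upper one iff \<open>s\<close>, whatever
  the orientations. The left leg of \<open>Cup a\<close> is oriented upwards iff \<open>a\<close>; all other orientations
  propagate from the cups.
\<close>

datatype event = Cross bool | Cup bool | Cap

type_synonym diagram = "(nat \<times> event) list"

text \<open>\<open>tangle d s t\<close>: \<open>d\<close> is an oriented tangle diagram with bottom ends \<open>s\<close> and top ends \<open>t\<close>,
  where \<open>True\<close> stands for upwards.\<close>

inductive slice :: "nat \<times> event \<Rightarrow> bool list \<Rightarrow> bool list \<Rightarrow> bool"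
  where
    "slice (length u + 1, Cross s) (u @ [a, b] @ v) (u @ [b, a] @ v)"
  | "slice (length u + 1, Cup a) (u @ v) (u @ [a, \<not> a] @ v)"
  | "slice (length u + 1, Cap) (u @ [a, \<not> a] @ v) (u @ v)"

inductive tangle :: "diagram \<Rightarrow> bool list \<Rightarrow> bool list \<Rightarrow> bool"
  where
    "tangle [] s s"
  | "\<lbrakk>tangle d s t; slice x t t'\<rbrakk> \<Longrightarrow> tangle (x # d) s t'"

definition link_diagram :: "diagram \<Rightarrow> bool"
  where "link_diagram d \<longleftrightarrow> tangle d [] []"

fun ends_in :: "event \<Rightarrow> nat"
  where "ends_in (Cross s) = 2" | "ends_in (Cup a) = 0" | "ends_in Cap = 2"

fun ends_out :: "event \<Rightarrow> nat"
  where "ends_out (Cross s) = 2" | "ends_out (Cup a) = 2" | "ends_out Cap = 0"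

text \<open>
  Local moves: planar isotopies (exchange of the heights of two events side by side,
  straightening of a zigzag, a crossing passing over a maximum or a minimum), followed by the
  Reidemeister moves. The variants with other orientations or crossings are generated by these.
\<close>

inductive move :: "diagram \<Rightarrow> diagram \<Rightarrow> bool"
  where
    exchange: "p + ends_in e \<le> p' \<Longrightarrow>
      move [(p' + ends_out e - ends_in e, e'), (p, e)] [(p, e), (p', e')]"
  | zigzag_left: "move [(p, Cap), (p + 1, Cup a)] []"
  | zigzag_right: "move [(p + 1, Cap), (p, Cup a)] []"
  | slide_cap: "move [(p, Cap), (p + 1, Cross s)] [(p + 1, Cap), (p, Cross (\<not> s))]"
  | slide_cup: "move [(p + 1, Cross s), (p, Cup a)] [(p, Cross (\<not> s)), (p + 1, Cup a)]"
  | R1_cap: "move [(p, Cap), (p, Cross s)] [(p, Cap)]"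
  | R1_cup: "move [(p, Cross s), (p, Cup a)] [(p, Cup (\<not> a))]"
  | R2: "move [(p, Cross s), (p, Cross (\<not> s))] []"
  | R3: "move [(p, Cross s), (p + 1, Cross s), (p, Cross s)]
              [(p + 1, Cross s), (p, Cross s), (p + 1, Cross s)]"

definition diagram_step :: "diagram \<Rightarrow> diagram \<Rightarrow> bool"
  where "diagram_step d d' \<longleftrightarrow> link_diagram d \<and> link_diagram d' \<and>
    (\<exists>d1 d2 m m'. move m m' \<and> d = d1 @ m @ d2 \<and> d' = d1 @ m' @ d2)"

definition same_link :: "diagram \<Rightarrow> diagram \<Rightarrow> bool"
  where "same_link = equivclp diagram_step"

definition link_invariant :: "(diagram \<Rightarrow> 'a) \<Rightarrow> bool"
  where "link_invariant f \<longleftrightarrow>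
    (\<forall>d d'. link_diagram d \<longrightarrow> link_diagram d' \<longrightarrow> same_link d d' \<longrightarrow> f d = f d')"

definition braid_closure :: "nat \<Rightarrow> braid \<Rightarrow> diagram"
  where "braid_closure k b =
    map (\<lambda>i. (i, Cap)) [1..<k+1] @ map (\<lambda>(i, s). (i, Cross s)) b @
    map (\<lambda>i. (i, Cup True)) (rev [1..<k+1])"

text \<open>
  The Conway-normalized Alexander polynomial with \<open>t = q^{-2}\<close>. A crossing of two strands that
  both go up or both go down is positive iff it is \<open>Cross True\<close>, and its oriented smoothing
  consists of two vertical strands. A crossing of an upward and a downward strand is positive iff
  it is \<open>Cross False\<close>, and its oriented smoothing is a maximum below a minimum.
\<close>

definition alexander_polynomial :: "(diagram \<Rightarrow> qfield) \<Rightarrow> bool"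
  where "alexander_polynomial \<Delta> \<longleftrightarrow>
    link_invariant \<Delta> \<and>
    (\<forall>a. \<Delta> [(1, Cap), (1, Cup a)] = 1) \<and>
    (\<forall>d1 d2 u v a p. p = length u + 1 \<longrightarrow>
       tangle d2 [] (u @ [a, a] @ v) \<longrightarrow> tangle d1 (u @ [a, a] @ v) [] \<longrightarrow>
       \<Delta> (d1 @ [(p, Cross True)] @ d2) - \<Delta> (d1 @ [(p, Cross False)] @ d2)
         = (inverse q - q) * \<Delta> (d1 @ d2)) \<and>
    (\<forall>d1 d2 u v a p. p = length u + 1 \<longrightarrow>
       tangle d2 [] (u @ [a, \<not> a] @ v) \<longrightarrow> tangle d1 (u @ [\<not> a, a] @ v) [] \<longrightarrow>
       \<Delta> (d1 @ [(p, Cross False)] @ d2) - \<Delta> (d1 @ [(p, Cross True)] @ d2)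
         = (inverse q - q) * \<Delta> (d1 @ [(p, Cup (\<not> a)), (p, Cap)] @ d2))"

end

theory Submission
  imports Defs
begin

text \<open>
  Both sides of the identity are functions of a braid on \<open>m\<close> strands that satisfy the skein
  relation and the braid relations, so they factor through the Hecke algebra, where every braid is a
  combination of elements \<open>x\<close> and \<open>x \<sigma> y\<close> with \<open>\<sigma> = \<sigma>_{m-1}\<close> and \<open>x, y\<close> braids on \<open>m - 1\<close>
  strands. Closing the last strand sends \<open>x\<close> to \<open>[\<beta>] x = 0\<close> and \<open>x \<sigma> y\<close> to \<open>x y\<close>. The Alexander
  polynomial behaves in the same way: by a Markov move it takes the same value on the closures of
  \<open>x \<sigma>\<close>, \<open>x \<sigma>\<^sup>-\<^sup>1\<close> and \<open>x\<close>, and then by the skein relation it vanishes on \<open>x\<close> regarded as a braid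
  on \<open>m\<close> strands. Induction on \<open>m\<close> gives the case \<open>j = 1\<close>; the general case follows because the
  Alexander polynomial of a closure does not change under conjugation.
\<close>

section \<open>The ground field\<close>

text \<open>The algebra is really a category: a relation belongs to a source weight, and a
  congruence may be multiplied on the right only by an element all of whose words reach the weight
  at which it holds. Commutations hold at every weight, but crossings invert and braid only where
  adjacent entries are 1, so weights must be tracked. The evaluations come from zero objects: a
  negative entry on the left, or an entry above \<beta> on the right, kills one order of the pair
  E_i, F_i, and the commutator turns the other order into a quantum integer. The rank never changes:
  braids on fewer strands live in the same algebra at weights with zeros in the middle, and the
  induction on the number of strands runs downward over the index s of the innermost arc still
  present. The Hecke algebra enters only through its relations: the set of braids on which both
  sides agree is closed under them, which carries agreement from the normal forms to all braids. A
  crossing closed to the right gives 1 for both signs because its scalar part, q or 1/q, multiplies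
  a circle, and a circle is [0] = 0.\<close>

lemma q_nonzero [simp]: "q \<noteq> 0"
  by (simp add: q_def Zero_fract_def eq_fract)

lemma q_plus_inverse_nonzero: "q + inverse q \<noteq> 0"
  by (simp add: q_def Zero_fract_def eq_fract one_pCons)

lemma q_minus_inverse_nonzero: "q - inverse q \<noteq> 0"
  by (simp add: q_def Zero_fract_def eq_fract one_pCons)

lemma qint_0 [simp]: "qint 0 = 0"
  by (simp add: qint_def)

lemma qint_1 [simp]: "qint 1 = 1" "qint (- 1) = - 1"
  using q_minus_inverse_nonzero by (simp_all add: qint_def divide_simps)

lemma qint_2: "qint 2 = q + inverse q"
proof -
  have "q powi 2 - q powi (- 2) = (q + inverse q) * (q - inverse q)"
    by (simp add: power_int_minus power2_eq_square algebra_simps)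
  then show ?thesis
    using q_minus_inverse_nonzero by (simp add: qint_def)
qed

lemma qint_minus: "qint (- n) = - qint n"
  by (simp add: qint_def minus_divide_left)

text \<open>Moving E_j E_j past F_j F_j in \<open>EEFF_eqv\<close> leaves [3] + 1; this must match
  the square of the Serre coefficient [2] for the two to cancel.\<close>

lemma qint_3: "qint 3 + 1 = (q + inverse q) * (q + inverse q)"
proof -
  have "q powi 3 - q powi (- 3) = ((q + inverse q) * (q + inverse q) - 1) * (q - inverse q)"
    by (simp add: power_int_minus power3_eq_cube algebra_simps)
  then show ?thesis
    using q_minus_inverse_nonzero by (simp add: qint_def)
qed


section \<open>Congruence in the doubled Schur algebra\<close>

lemma free_alg_induct [case_names zero add]:
  fixes x :: free_alg
  assumes "P 0" and "\<And>x u c. P x \<Longrightarrow> P (x + Poly_Mapping.single u c)"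
  shows "P x"
proof (induction x rule: update_induct)
  case const
  then show ?case by (rule assms(1))
next
  case (update f a b)
  have "Poly_Mapping.update a b f = f + Poly_Mapping.single a b"
    using update(1)
    by (intro poly_mapping_eqI) (auto simp: lookup_update lookup_add lookup_single in_keys_iff when_def)
  then show ?case using assms(2) update by simp
qed

lemma scalar_simps:
  "scalar 0 = 0" "scalar 1 = 1" "scalar (c + d) = scalar c + scalar d"
  "scalar (c - d) = scalar c - scalar d" "scalar (- c) = - scalar c"
  "scalar (c * d) = scalar c * scalar d"
  by (simp_all add: scalar_def single_add single_diff single_uminus mult_single)

lemma scalar_times_single: "scalar c * Poly_Mapping.single u d = Poly_Mapping.single u (c * d)"
  and single_times_scalar: "Poly_Mapping.single u d * scalar c = Poly_Mapping.single u (c * d)"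
  by (simp_all add: scalar_def mult_single mult.commute)

lemma scalar_central: "x * scalar c = scalar c * x"
  by (induction x rule: free_alg_induct)
    (simp_all add: scalar_times_single single_times_scalar algebra_simps)

lemma scalar_left_commute: "x * (scalar c * y) = scalar c * (x * y)"
  by (metis mult.assoc scalar_central)

lemmas scalar_commute =
  scalar_central[of "E i"] scalar_central[of "F i"] scalar_left_commute[of "E i"]
  scalar_left_commute[of "F i"] for i

section \<open>Weights and homogeneous elements\<close>

lemma target_zero [simp]: "target 0 \<nu> = \<nu>"
  by (simp add: target_def zero_word_def)

lemma target_plus: "target (u + v) \<nu> = target u (target v \<nu>)"
  by (simp add: target_def plus_word_def)

text \<open>Relations are attached to a source weight, so multiplying a congruence on the right by x
  requires that the words of x do not end at different weights. This is that side condition.\<close>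

definition leads :: "free_alg \<Rightarrow> weight \<Rightarrow> weight \<Rightarrow> bool"
  where "leads x \<nu> \<mu> \<longleftrightarrow> (\<forall>w \<in> Poly_Mapping.keys x. target w \<nu> = \<mu>)"

lemma leads_E: "leads (E i) \<nu> (shift (GenE i) \<nu>)"
  and leads_F: "leads (F i) \<nu> (shift (GenF i) \<nu>)"
  by (simp_all add: leads_def E_def F_def target_def)

lemma leads_one: "leads 1 \<nu> \<nu>"
  by (simp add: leads_def)

lemma leads_scalar: "leads (scalar c) \<nu> \<nu>"
  by (simp add: leads_def scalar_def)

lemma leads_mult: "leads x \<mu> \<kappa> \<Longrightarrow> leads y \<nu> \<mu> \<Longrightarrow> leads (x * y) \<nu> \<kappa>"
  unfolding leads_def using keys_mult[of x y] by (fastforce simp: target_plus)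

lemma leads_diff: "leads x \<nu> \<mu> \<Longrightarrow> leads y \<nu> \<mu> \<Longrightarrow> leads (x - y) \<nu> \<mu>"
  unfolding leads_def using keys_diff[of x y] by blast

lemmas leads_intros = leads_mult leads_E leads_F leads_one leads_scalar

lemma shift_inverse [simp]:
  "shift (GenE i) (shift (GenF i) \<nu>) = \<nu>" "shift (GenF i) (shift (GenE i) \<nu>) = \<nu>"
  by (auto simp: fun_eq_iff)

lemma leads_EF: "leads (E i * F i) \<nu> \<nu>"
  by (metis leads_mult leads_E leads_F shift_inverse(1))

lemma leads_braid_image: "leads (braid_image b) \<nu> \<nu>"
proof (induction b)
  case (Cons a b)
  then show ?case
    by (cases a) (auto simp: braid_image_def intro!: leads_mult[of _ \<nu> \<nu> _ \<nu>] leads_diff leads_scalar leads_EF)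
qed (simp add: braid_image_def leads_one)


section \<open>Ideal properties of the null combinations and the resulting congruence\<close>

locale doubled_schur =
  fixes \<beta> :: int and k l :: nat
begin

abbreviation vanishes :: "weight \<Rightarrow> free_alg \<Rightarrow> bool"
  where "vanishes \<nu> x \<equiv> x \<in> null \<beta> k l \<nu>"

lemma vanishes_single_mult:
  "vanishes \<nu> x \<Longrightarrow> vanishes \<nu> (Poly_Mapping.single u c * x)"
proof (induction rule: null.induct)
  case null_zero
  then show ?case by (simp add: null.null_zero)
next
  case (null_add x y)
  then show ?case by (simp add: distrib_left null.null_add)
next
  case (null_rel v r u' c')
  then show ?case
    using null.null_rel[of \<beta> k l v \<nu> r "u + u'" "c * c'"]
    by (simp add: mult.assoc[symmetric] mult_single)
qed

lemma vanishes_mult_left: "vanishes \<nu> x \<Longrightarrow> vanishes \<nu> (a * x)"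
  by (induction a rule: free_alg_induct)
    (auto simp: distrib_right intro: null.intros vanishes_single_mult)

lemma vanishes_mult_single:
  "vanishes (target w \<nu>) x \<Longrightarrow> vanishes \<nu> (x * Poly_Mapping.single w c)"
proof (induction rule: null.induct)
  case null_zero
  then show ?case by (simp add: null.null_zero)
next
  case (null_add x y)
  then show ?case by (simp add: distrib_right null.null_add)
next
  case (null_rel v r u c')
  \<comment> \<open>Spanning elements of \<open>null\<close> have coefficient 1 on the right, so the
    scalar of the right factor is carried to the front.\<close>
  have "Poly_Mapping.single u c' * r * Poly_Mapping.single v 1 * Poly_Mapping.single w c
      = scalar c * (Poly_Mapping.single u c' * r * Poly_Mapping.single (v + w) 1)"
    by (simp add: mult.assoc mult_single scalar_left_commute[symmetric] scalar_times_single)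
  then show ?case
    using null.null_rel[of \<beta> k l "v + w" \<nu> r u c'] null_rel by (simp add: target_plus vanishes_mult_left)
qed

lemma vanishes_sum: "(\<And>w. w \<in> A \<Longrightarrow> vanishes \<nu> (g w)) \<Longrightarrow> vanishes \<nu> (sum g A)"
  by (induction A rule: infinite_finite_induct) (auto intro: null.intros)

lemma free_alg_eq_sum: "x = (\<Sum>w\<in>Poly_Mapping.keys x. Poly_Mapping.single w (Poly_Mapping.lookup x w))"
  for x :: free_alg
  by (intro poly_mapping_eqI) (auto simp: lookup_sum lookup_single when_def in_keys_iff)

lemma vanishes_mult_right:
  assumes "vanishes \<mu> x" and "leads a \<nu> \<mu>"
  shows "vanishes \<nu> (x * a)"
proof -
  have "x * a = (\<Sum>w\<in>Poly_Mapping.keys a. x * Poly_Mapping.single w (Poly_Mapping.lookup a w))"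
    by (subst free_alg_eq_sum[of a]) (simp add: sum_distrib_left)
  also have "vanishes \<nu> \<dots>"
    using assms by (intro vanishes_sum vanishes_mult_single) (auto simp: leads_def)
  finally show ?thesis .
qed

lemma vanishes_uminus: "vanishes \<nu> x \<Longrightarrow> vanishes \<nu> (- x)"
  using vanishes_mult_left[of x \<nu> "- 1"] by simp

lemma vanishes_diff: "vanishes \<nu> x \<Longrightarrow> vanishes \<nu> y \<Longrightarrow> vanishes \<nu> (x - y)"
  using null_add[OF _ vanishes_uminus] by fastforce

lemma vanishes_rel: "rel \<beta> k l \<nu> r \<Longrightarrow> vanishes \<nu> r"
  using null_rel[of \<beta> k l 0 \<nu> r 0 1] by simp

lemma vanishes_zero_object: "\<nu> \<notin> weights \<beta> k l \<Longrightarrow> vanishes \<nu> x"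
  using vanishes_mult_left[OF vanishes_rel[OF zero_object], of \<nu> x] by simp

definition eqv :: "weight \<Rightarrow> free_alg \<Rightarrow> free_alg \<Rightarrow> bool"
  where "eqv \<nu> x y \<longleftrightarrow> vanishes \<nu> (x - y)"

lemma eqv_refl [simp, intro]: "eqv \<nu> x x"
  by (simp add: eqv_def null_zero)

lemma eqv_sym: "eqv \<nu> x y \<Longrightarrow> eqv \<nu> y x"
  unfolding eqv_def using vanishes_uminus[of "x - y" \<nu>] by simp

lemma eqv_trans [trans]: "eqv \<nu> x y \<Longrightarrow> eqv \<nu> y z \<Longrightarrow> eqv \<nu> x z"
  unfolding eqv_def using null_add[of "x - y" \<beta> k l \<nu> "y - z"] by simp

lemma eqv_add: "eqv \<nu> x x' \<Longrightarrow> eqv \<nu> y y' \<Longrightarrow> eqv \<nu> (x + y) (x' + y')"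
  unfolding eqv_def using null_add[of "x - x'" \<beta> k l \<nu> "y - y'"] by (simp add: algebra_simps)

lemma eqv_diff: "eqv \<nu> x x' \<Longrightarrow> eqv \<nu> y y' \<Longrightarrow> eqv \<nu> (x - y) (x' - y')"
  unfolding eqv_def using vanishes_diff[of "x - x'" \<nu> "y - y'"] by (simp add: algebra_simps)

lemma eqv_left: "eqv \<nu> x y \<Longrightarrow> eqv \<nu> (a * x) (a * y)"
  unfolding eqv_def right_diff_distrib[symmetric] by (rule vanishes_mult_left)

lemma eqv_right: "eqv \<mu> x y \<Longrightarrow> leads a \<nu> \<mu> \<Longrightarrow> eqv \<nu> (x * a) (y * a)"
  unfolding eqv_def left_diff_distrib[symmetric] by (rule vanishes_mult_right)

lemma eqv_context: "leads v \<nu> \<mu> \<Longrightarrow> eqv \<mu> x y \<Longrightarrow> eqv \<nu> (u * x * v) (u * y * v)"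
  by (simp add: eqv_left eqv_right mult.assoc)

lemma eqv_scalar_cancel:
  assumes "c \<noteq> 0" and "eqv \<nu> (scalar c * x) (scalar c * y)"
  shows "eqv \<nu> x y"
proof -
  have "scalar (inverse c) * (scalar c * z) = z" for z
    using assms(1) by (simp add: mult.assoc[symmetric] scalar_simps(6)[symmetric] scalar_simps(2))
  then show ?thesis using eqv_left[OF assms(2), of "scalar (inverse c)"] by simp
qed

lemma eqv_zero_object: "\<nu> \<notin> weights \<beta> k l \<Longrightarrow> eqv \<nu> x y"
  by (simp add: eqv_def vanishes_zero_object)

text \<open>Anything that factors through a zero object vanishes; the one-sided evaluations of E_i
  and F_i below rest on this.\<close>

lemma eqv_mult_zero_object:
  "leads v \<nu> \<mu> \<Longrightarrow> \<mu> \<notin> weights \<beta> k l \<Longrightarrow> eqv \<nu> (u * v) 0"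
  using eqv_right[OF eqv_zero_object, of \<mu> v \<nu> u 0] by simp


section \<open>Local computations\<close>

lemma EF_eqv:
  assumes "1 \<le> i" "i < k + l"
  shows "eqv \<nu> (E i * F i) (F i * E i + scalar (qint (\<nu> i - \<nu> (Suc i))))"
  using vanishes_rel[OF commutator[of i k l i \<beta> \<nu>]] assms by (simp add: eqv_def algebra_simps)

lemma EF_commute:
  assumes "1 \<le> i" "i < k + l" "1 \<le> j" "j < k + l" "i \<noteq> j"
  shows "eqv \<nu> (E i * F j) (F j * E i)"
  using vanishes_rel[OF commutator[of i k l j \<beta> \<nu>]] assms by (simp add: eqv_def)

lemma EE_commute:
  assumes "1 \<le> i" "i < k + l" "1 \<le> j" "j < k + l" "Suc i < j \<or> Suc j < i"
  shows "eqv \<nu> (E i * E j) (E j * E i)"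
  using vanishes_rel[OF far_E[of i k l j \<beta> \<nu>]] assms by (simp add: eqv_def)

lemma FF_commute:
  assumes "1 \<le> i" "i < k + l" "1 \<le> j" "j < k + l" "Suc i < j \<or> Suc j < i"
  shows "eqv \<nu> (F i * F j) (F j * F i)"
  using vanishes_rel[OF far_F[of i k l j \<beta> \<nu>]] assms by (simp add: eqv_def)

lemma not_weights:
  assumes "1 \<le> i \<and> i \<le> k \<and> \<nu> i < 0 \<or> k < i \<and> i \<le> k + l \<and> \<beta> < \<nu> i"
  shows "\<nu> \<notin> weights \<beta> k l"
proof
  assume "\<nu> \<in> weights \<beta> k l"
  then have "i \<in> {1..k} \<Longrightarrow> 0 \<le> \<nu> i" "i \<in> {k+1..k+l} \<Longrightarrow> \<nu> i \<le> \<beta>"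
    unfolding weights_def by blast+
  then show False using assms by auto
qed

text \<open>F_i lowers entry i and raises entry i + 1. For i = k, where the two halves meet, either
  bound can be violated. E_k violates neither, which is why \<open>FE_zero\<close> omits i = k and
  why cups can be created there.\<close>

lemma EF_zero:
  assumes "1 \<le> i" "i \<le> k \<and> \<nu> i = 0 \<or> k \<le> i \<and> i < k + l \<and> \<nu> (Suc i) = \<beta>"
  shows "eqv \<nu> (x * F i) 0"
proof (rule eqv_mult_zero_object[OF leads_F])
  show "shift (GenF i) \<nu> \<notin> weights \<beta> k l"
    using assms not_weights[of i "shift (GenF i) \<nu>"] not_weights[of "Suc i" "shift (GenF i) \<nu>"] by auto
qed

lemma FE_zero:
  assumes "1 \<le> i" "i < k \<and> \<nu> (Suc i) = 0 \<or> k < i \<and> i \<le> k + l \<and> \<nu> i = \<beta>"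
  shows "eqv \<nu> (x * E i) 0"
proof (rule eqv_mult_zero_object[OF leads_E])
  show "shift (GenE i) \<nu> \<notin> weights \<beta> k l"
    using assms not_weights[of i "shift (GenE i) \<nu>"] not_weights[of "Suc i" "shift (GenE i) \<nu>"] by auto
qed

text \<open>F_i leaves the weights at \<open>\<nu>\<close>, so the commutator relation has only one
  surviving product.\<close>

lemma FE_eqv:
  assumes "1 \<le> i" "i < k + l" "i \<le> k \<and> \<nu> i = 0 \<or> k \<le> i \<and> \<nu> (Suc i) = \<beta>"
  shows "eqv \<nu> (F i * E i) (scalar (- qint (\<nu> i - \<nu> (Suc i))))"
proof -
  have "eqv \<nu> (F i * E i + scalar (qint (\<nu> i - \<nu> (Suc i)))) 0"
    using assms by (intro eqv_trans[OF eqv_sym[OF EF_eqv] EF_zero]) auto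
  then show ?thesis by (simp add: eqv_def scalar_simps)
qed

lemma EF_eqv_scalar:
  assumes "1 \<le> i" "i < k + l" "i < k \<and> \<nu> (Suc i) = 0 \<or> k < i \<and> \<nu> i = \<beta>"
  shows "eqv \<nu> (E i * F i) (scalar (qint (\<nu> i - \<nu> (Suc i))))"
  using eqv_trans[OF EF_eqv eqv_add[OF FE_zero eqv_refl]] assms by fastforce

end

text \<open>For commutations, which hold at every weight, it is enough that each source has some
  target; the target need not be computed.\<close>

definition homogeneous :: "free_alg \<Rightarrow> bool"
  where "homogeneous x \<longleftrightarrow> (\<forall>\<nu>. \<exists>\<mu>. leads x \<nu> \<mu>)"

lemma homogeneous_E: "homogeneous (E i)" and homogeneous_F: "homogeneous (F i)"
  and homogeneous_one: "homogeneous 1"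
  unfolding homogeneous_def by (blast intro: leads_intros)+

lemma homogeneous_mult: "homogeneous x \<Longrightarrow> homogeneous y \<Longrightarrow> homogeneous (x * y)"
  unfolding homogeneous_def by (meson leads_mult)

lemma homogeneous_braid_image: "homogeneous (braid_image b)"
  unfolding homogeneous_def by (blast intro: leads_braid_image)

lemma homogeneous_prod_list: "(\<And>x. x \<in> set xs \<Longrightarrow> homogeneous x) \<Longrightarrow> homogeneous (prod_list xs)"
  by (induction xs) (auto intro: homogeneous_one homogeneous_mult)

lemma braid_image_Nil [simp]: "braid_image [] = 1"
  by (simp add: braid_image_def)

lemma braid_image_Cons:
  "braid_image ((i, s) # b) = (scalar (if s then inverse q else q) - E i * F i) * braid_image b"
  by (simp add: braid_image_def)

lemma braid_image_append: "braid_image (b @ b') = braid_image b * braid_image b'"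
  by (simp add: braid_image_def)

context doubled_schur
begin

text \<open>The equations for both ends absorb the rebracketing, so a rewrite inside a long product
  needs only associativity and the weight reached by its right factor.\<close>

lemma eqv_step:
  assumes "a = u * x * v" and "b = u * y * v" and "leads v \<nu> \<mu>" and "eqv \<mu> x y"
  shows "eqv \<nu> a b"
  using eqv_context assms by simp

section \<open>Elements that commute at every weight\<close>

definition commutes :: "free_alg \<Rightarrow> free_alg \<Rightarrow> bool"
  where "commutes x y \<longleftrightarrow> (\<forall>\<nu>. eqv \<nu> (x * y) (y * x))"

lemma commutes_sym: "commutes x y \<Longrightarrow> commutes y x"
  by (simp add: commutes_def eqv_sym)

lemma commutes_scalar: "commutes x (scalar c)"
  by (simp add: commutes_def scalar_central)

lemma commutes_diff: "commutes x y \<Longrightarrow> commutes x z \<Longrightarrow> commutes x (y - z)"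
  by (simp add: commutes_def algebra_simps eqv_diff)

lemma commutes_mult:
  assumes "commutes x y" "commutes x z" "homogeneous z"
  shows "commutes x (y * z)"
  unfolding commutes_def
proof
  fix \<nu>
  obtain \<mu> where "leads z \<nu> \<mu>" using assms(3) by (auto simp: homogeneous_def)
  then have "eqv \<nu> (x * y * z) (y * x * z)"
    using assms(1) by (auto simp: commutes_def intro: eqv_right)
  also have "eqv \<nu> (y * x * z) (y * (z * x))"
    using assms(2) by (auto simp: commutes_def mult.assoc intro: eqv_left)
  finally show "eqv \<nu> (x * (y * z)) (y * z * x)" by (simp add: mult.assoc)
qed

lemma commutes_prod_list:
  "(\<And>y. y \<in> set ys \<Longrightarrow> commutes x y \<and> homogeneous y) \<Longrightarrow> commutes x (prod_list ys)"
proof (induction ys)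
  case Nil
  then show ?case by (simp add: commutes_def)
next
  case (Cons y ys)
  then show ?case by (auto intro!: commutes_mult homogeneous_prod_list)
qed

lemma commutes_EF: "\<lbrakk>1 \<le> i; i < k + l; 1 \<le> j; j < k + l; i \<noteq> j\<rbrakk> \<Longrightarrow> commutes (E i) (F j)"
  and commutes_FE: "\<lbrakk>1 \<le> i; i < k + l; 1 \<le> j; j < k + l; i \<noteq> j\<rbrakk> \<Longrightarrow> commutes (F i) (E j)"
  by (simp_all add: commutes_def EF_commute eqv_sym)

lemma commutes_EE:
    "\<lbrakk>1 \<le> i; i < k + l; 1 \<le> j; j < k + l; Suc i < j \<or> Suc j < i\<rbrakk> \<Longrightarrow> commutes (E i) (E j)"
  and commutes_FF:
    "\<lbrakk>1 \<le> i; i < k + l; 1 \<le> j; j < k + l; Suc i < j \<or> Suc j < i\<rbrakk> \<Longrightarrow> commutes (F i) (F j)"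
  by (auto simp: commutes_def EE_commute FF_commute)

lemma commutes_EF_pair:
  assumes "1 \<le> i" "i < k + l" "1 \<le> j" "j < k + l" "Suc i < j \<or> Suc j < i"
  shows "commutes (E i) (E j * F j)" "commutes (F i) (E j * F j)" "commutes (E i * F i) (E j * F j)"
proof -
  show *: "commutes (E i) (E j * F j)" "commutes (F i) (E j * F j)"
    using assms
    by (auto intro!: commutes_mult commutes_EE commutes_EF commutes_FE commutes_FF homogeneous_F)
  show "commutes (E i * F i) (E j * F j)"
    by (intro commutes_sym[OF commutes_mult] commutes_sym[OF *(1)] commutes_sym[OF *(2)] homogeneous_F)
qed

lemma commutes_braid_image:
  assumes "\<And>i s. (i, s) \<in> set b \<Longrightarrow> commutes x (E i * F i)"
  shows "commutes x (braid_image b)"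
  using assms
proof (induction b)
  case Nil
  then show ?case by (simp add: commutes_def)
next
  case (Cons c b)
  obtain i s where c: "c = (i, s)" by (cases c)
  then show ?case
    using Cons.prems[of i s] Cons.IH Cons.prems unfolding c braid_image_Cons
    by (auto intro!: commutes_mult[OF commutes_diff[OF commutes_scalar]] homogeneous_braid_image)
qed

lemma far_crossings_commute:
  assumes "1 \<le> i" "i < k + l" "1 \<le> j" "j < k + l" "Suc i < j \<or> Suc j < i"
  shows "commutes (braid_image [(i, s)]) (braid_image [(j, t)])"
proof (rule commutes_braid_image)
  fix i' s' assume "(i', s') \<in> set [(j, t)]"
  then have "commutes (E i' * F i') (braid_image [(i, s)])"
    using assms by (intro commutes_braid_image commutes_EF_pair) auto
  then show "commutes (braid_image [(i, s)]) (E i' * F i')"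
    by (rule commutes_sym)
qed

text \<open>F_i takes the entries (1, 1) to (0, 2). There F_i leaves the weights, so the inner F_i
  E_i is the scalar - [0 - 2] = [2].\<close>

lemma EF_square:
  assumes "1 \<le> i" "i < k" "\<nu> i = 1" "\<nu> (Suc i) = 1"
  shows "eqv \<nu> (E i * F i * (E i * F i)) (scalar (q + inverse q) * (E i * F i))"
proof -
  let ?\<mu> = "shift (GenF i) \<nu>"
  have "eqv \<nu> (E i * F i * (E i * F i)) (E i * scalar (- qint (?\<mu> i - ?\<mu> (Suc i))) * F i)"
    using assms by (intro eqv_step[where u = "E i" and x = "F i * E i" and v = "F i", OF _ refl leads_F FE_eqv])
      (auto simp: mult.assoc)
  moreover have "- qint (?\<mu> i - ?\<mu> (Suc i)) = q + inverse q"
    using assms by (simp add: qint_2 qint_minus)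
  ultimately show ?thesis by (simp add: scalar_commute mult.assoc)
qed

lemma crossing_inverse:
  assumes "1 \<le> i" "i < k" "\<nu> i = 1" "\<nu> (Suc i) = 1"
  shows "eqv \<nu> (braid_image [(i, s), (i, \<not> s)]) 1"
proof -
  define a where "a = scalar (if s then inverse q else q)"
  define d where "d = scalar (if s then q else inverse q)"
  define e where "e = E i * F i"
  have "braid_image [(i, s), (i, \<not> s)] = (a - e) * (d - e)"
    by (cases s) (simp_all add: braid_image_Cons a_def d_def e_def)
  also have "\<dots> = a * d - (a + d) * e + e * e"
    using scalar_central[of e] by (simp add: d_def algebra_simps)
  also have "\<dots> = 1 - scalar (q + inverse q) * e + e * e"
  proof -
    have "a * d = 1"
      by (cases s) (simp_all add: a_def d_def scalar_simps(2) flip: scalar_simps(6))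
    moreover have "a + d = scalar (q + inverse q)"
      by (cases s) (simp_all add: a_def d_def scalar_simps(3))
    ultimately show ?thesis by simp
  qed
  also have "eqv \<nu> \<dots> (1 - scalar (q + inverse q) * e + scalar (q + inverse q) * e)"
    unfolding e_def by (intro eqv_add eqv_refl EF_square assms)
  finally show ?thesis by simp
qed

text \<open>With e, e' for E_i F_i and its successor, this and \<open>EF_EF_EF_down\<close> show
  that e e' e - e and e' e e' - e' are the same element E_i F_j E_j F_i, j = i + 1. Here
  commutations bring F_i next to the second E_i at the entries (0, 1, 2), where their product is
  1.\<close>

lemma EF_EF_EF_up:
  assumes "1 \<le> i" "Suc i < k" "\<nu> i = 1" "\<nu> (Suc i) = 1" "\<nu> (Suc (Suc i)) = 1"
  shows "eqv \<nu> (E i * F i * (E (Suc i) * F (Suc i)) * (E i * F i))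
    (E i * F (Suc i) * E (Suc i) * F i + E i * F i)"
proof -
  let ?j = "Suc i"
  have "eqv \<nu> (E i * F i * (E ?j * F ?j) * (E i * F i)) (E i * E ?j * F i * F ?j * E i * F i)"
    by (rule eqv_step[where u = "E i" and x = "F i * E ?j" and y = "E ?j * F i" and v = "F ?j * E i * F i"],
        (simp add: mult.assoc)+, (rule leads_intros)+, rule eqv_sym[OF EF_commute]) (use assms in auto)
  also have "eqv \<nu> \<dots> (E i * E ?j * F i * E i * F ?j * F i)"
    by (rule eqv_step[where u = "E i * E ?j * F i" and x = "F ?j * E i" and y = "E i * F ?j" and v = "F i"],
        (simp add: mult.assoc)+, (rule leads_intros)+, rule eqv_sym[OF EF_commute]) (use assms in auto)
  also have "eqv \<nu> \<dots> (E i * E ?j * 1 * F ?j * F i)"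
  proof (rule eqv_step[where u = "E i * E ?j" and x = "F i * E i" and v = "F ?j * F i" and y = 1])
    let ?\<mu> = "shift (GenF ?j) (shift (GenF i) \<nu>)"
    show "leads (F ?j * F i) \<nu> ?\<mu>" by (rule leads_intros)+
    show "eqv ?\<mu> (F i * E i) 1"
      using FE_eqv[of i ?\<mu>] assms by (simp add: scalar_simps)
  qed (simp_all add: mult.assoc)
  also have "eqv \<nu> \<dots> (E i * (F ?j * E ?j + 1) * F i)"
  proof (rule eqv_step[where u = "E i" and x = "E ?j * F ?j" and v = "F i"])
    let ?\<mu> = "shift (GenF i) \<nu>"
    show "leads (F i) \<nu> ?\<mu>" by (rule leads_intros)+
    show "eqv ?\<mu> (E ?j * F ?j) (F ?j * E ?j + 1)"
      using EF_eqv[of ?j ?\<mu>] assms by (simp add: scalar_simps)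
  qed (simp_all add: mult.assoc)
  finally show ?thesis by (simp add: algebra_simps)
qed

text \<open>Commutators reduce the product to F_j (E_j F_j) E_j + F_j E_j. The inner E_j F_j acts at
  the entries (3, 0), where E_j leaves the weights, hence as [3].\<close>

lemma EEFF_eqv:
  assumes "1 \<le> j" "j < k" "\<nu> j = 2" "\<nu> (Suc j) = 1"
  shows "eqv \<nu> (E j * E j * F j * F j) (scalar ((q + inverse q) * (q + inverse q)) * (F j * E j))"
proof -
  have EF: "eqv \<nu> (E j * F j) (F j * E j + 1)"
    using EF_eqv[of j \<nu>] assms by (simp add: scalar_simps)
  have "eqv \<nu> (E j * E j * F j * F j) (E j * (F j * E j - 1) * F j)"
  proof (rule eqv_step[where u = "E j" and x = "E j * F j" and v = "F j"])
    let ?\<mu> = "shift (GenF j) \<nu>"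
    show "leads (F j) \<nu> ?\<mu>" by (rule leads_intros)+
    show "eqv ?\<mu> (E j * F j) (F j * E j - 1)"
      using EF_eqv[of j ?\<mu>] assms by (simp add: scalar_simps)
  qed (simp_all add: mult.assoc)
  also have "\<dots> = (E j * F j) * (E j * F j) - E j * F j"
    by (simp add: algebra_simps)
  also have "eqv \<nu> \<dots> ((F j * E j + 1) * (E j * F j) - (F j * E j + 1))"
    by (intro eqv_diff EF eqv_right[OF EF] leads_EF)
  also have "eqv \<nu> \<dots> ((F j * E j + 1) * (F j * E j + 1) - (F j * E j + 1))"
    by (intro eqv_diff eqv_left[OF EF] eqv_refl)
  also have "\<dots> = F j * (E j * F j) * E j + F j * E j"
    by (simp add: algebra_simps)
  also have "eqv \<nu> \<dots> (F j * scalar (qint 3) * E j + F j * E j)"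
  proof (intro eqv_add eqv_refl eqv_context)
    let ?\<mu> = "shift (GenE j) \<nu>"
    show "leads (E j) \<nu> ?\<mu>" by (rule leads_intros)+
    show "eqv ?\<mu> (E j * F j) (scalar (qint 3))"
      using EF_eqv_scalar[of j ?\<mu>] assms by simp
  qed
  also have "\<dots> = scalar (qint 3 + 1) * (F j * E j)"
    by (simp add: scalar_commute mult.assoc scalar_simps(2,3) distrib_right)
  finally show ?thesis by (simp add: qint_3)
qed

text \<open>For a Serre relation in which one outer monomial factors through a zero object.\<close>

lemma eqv_of_serre: "\<lbrakk>eqv \<nu> (x - y + z) 0; eqv \<nu> z 0\<rbrakk> \<Longrightarrow> eqv \<nu> y x"
  and eqv_of_serre': "\<lbrakk>eqv \<nu> (x - y + z) 0; eqv \<nu> x 0\<rbrakk> \<Longrightarrow> eqv \<nu> y z"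
  using vanishes_diff[of z \<nu> "x - y + z"] vanishes_diff[of x \<nu> "x - y + z"]
  by (simp_all add: eqv_def)

text \<open>The Serre relations turn \<open>E_j E_i E_j F_j F_i F_j\<close> into \<open>E_i (E_j E_j F_j F_j) F_i\<close>
  divided by \<open>[2]\<^sup>2\<close>, because \<open>F_j F_j 1_\<nu>\<close> and its mirror image factor through zero objects.\<close>

lemma EEEFFF_eqv:
  assumes "1 \<le> i" "Suc i < k" "\<nu> i = 1" "\<nu> (Suc i) = 1" "\<nu> (Suc (Suc i)) = 1"
  shows "eqv \<nu> (E (Suc i) * E i * E (Suc i) * (F (Suc i) * F i * F (Suc i)))
    (E i * F (Suc i) * E (Suc i) * F i)"
proof -
  let ?j = "Suc i" and ?c = "q + inverse q"
  let ?\<mu> = "shift (GenF ?j) (shift (GenF i) (shift (GenF ?j) \<nu>))"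
  have "eqv \<nu> (F ?j * F ?j * F i - scalar ?c * F ?j * F i * F ?j + F i * F ?j * F ?j) 0"
    using vanishes_rel[OF serre_F[of ?j k l i \<beta> \<nu>]] assms by (simp add: eqv_def)
  moreover have "eqv \<nu> (F i * F ?j * F ?j) 0"
  proof (subst mult.assoc, rule eqv_mult_zero_object)
    show "leads (F ?j * F ?j) \<nu> (shift (GenF ?j) (shift (GenF ?j) \<nu>))" by (rule leads_intros)+
    show "shift (GenF ?j) (shift (GenF ?j) \<nu>) \<notin> weights \<beta> k l"
      using assms by (intro not_weights[of ?j]) auto
  qed
  ultimately have F: "eqv \<nu> (scalar ?c * (F ?j * F i * F ?j)) (F ?j * F ?j * F i)"
    unfolding mult.assoc by (rule eqv_of_serre)
  have "eqv ?\<mu> (E ?j * E ?j * E i - scalar ?c * E ?j * E i * E ?j + E i * E ?j * E ?j) 0"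
    using vanishes_rel[OF serre_E[of ?j k l i \<beta> ?\<mu>]] assms by (simp add: eqv_def)
  moreover have "eqv ?\<mu> (E ?j * E ?j * E i) 0"
    using assms by (intro FE_zero) auto
  ultimately have E: "eqv ?\<mu> (scalar ?c * (E ?j * E i * E ?j)) (E i * E ?j * E ?j)"
    unfolding mult.assoc by (rule eqv_of_serre')
  have "eqv \<nu> (scalar ?c * (E ?j * E i * E ?j) * (scalar ?c * (F ?j * F i * F ?j)))
      (E i * E ?j * E ?j * (scalar ?c * (F ?j * F i * F ?j)))"
    by (rule eqv_right[OF E]) ((rule leads_intros)+)
  also have "eqv \<nu> \<dots> (E i * E ?j * E ?j * (F ?j * F ?j * F i))"
    by (rule eqv_left[OF F])
  also have "eqv \<nu> \<dots> (E i * (scalar (?c * ?c) * (F ?j * E ?j)) * F i)"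
    by (rule eqv_step[where u = "E i" and x = "E ?j * E ?j * F ?j * F ?j" and v = "F i", OF _ refl leads_F EEFF_eqv])
      (use assms in \<open>auto simp: mult.assoc\<close>)
  finally have "eqv \<nu> (scalar (?c * ?c) * (E ?j * E i * E ?j * (F ?j * F i * F ?j)))
      (scalar (?c * ?c) * (E i * F ?j * E ?j * F i))"
    by (simp add: mult.assoc scalar_commute scalar_simps(6))
  then show ?thesis
    using q_plus_inverse_nonzero by (auto intro: eqv_scalar_cancel[of "?c * ?c"])
qed

text \<open>At the entries (0, 1, 2) the inner F_j E_j is not a scalar but E_j F_j + 1, unlike F_i
  E_i in \<open>EF_EF_EF_up\<close>. The resulting monomial of degree six is where the Serre
  relations come in.\<close>

lemma EF_EF_EF_down:
  assumes "1 \<le> i" "Suc i < k" "\<nu> i = 1" "\<nu> (Suc i) = 1" "\<nu> (Suc (Suc i)) = 1"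
  shows "eqv \<nu> (E (Suc i) * F (Suc i) * (E i * F i) * (E (Suc i) * F (Suc i)))
    (E i * F (Suc i) * E (Suc i) * F i + E (Suc i) * F (Suc i))"
proof -
  let ?j = "Suc i"
  have "eqv \<nu> (E ?j * F ?j * (E i * F i) * (E ?j * F ?j)) (E ?j * E i * F ?j * F i * E ?j * F ?j)"
    by (rule eqv_step[where u = "E ?j" and x = "F ?j * E i" and y = "E i * F ?j" and v = "F i * E ?j * F ?j"],
        (simp add: mult.assoc)+, (rule leads_intros)+, rule eqv_sym[OF EF_commute]) (use assms in auto)
  also have "eqv \<nu> \<dots> (E ?j * E i * F ?j * E ?j * F i * F ?j)"
    by (rule eqv_step[where u = "E ?j * E i * F ?j" and x = "F i * E ?j" and y = "E ?j * F i" and v = "F ?j"],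
        (simp add: mult.assoc)+, (rule leads_intros)+, rule eqv_sym[OF EF_commute]) (use assms in auto)
  also have "eqv \<nu> \<dots> (E ?j * E i * (E ?j * F ?j + 1) * (F i * F ?j))"
  proof (rule eqv_step[where u = "E ?j * E i" and x = "F ?j * E ?j" and v = "F i * F ?j"])
    let ?\<mu> = "shift (GenF i) (shift (GenF ?j) \<nu>)"
    show "leads (F i * F ?j) \<nu> ?\<mu>" by (rule leads_intros)+
    have "eqv ?\<mu> (E ?j * F ?j + 1) (F ?j * E ?j - 1 + 1)"
      using EF_eqv[of ?j ?\<mu>] assms by (intro eqv_add) (simp_all add: scalar_simps)
    then show "eqv ?\<mu> (F ?j * E ?j) (E ?j * F ?j + 1)"
      by (simp add: eqv_sym)
  qed (simp_all add: mult.assoc)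
  also have "\<dots> = E ?j * E i * E ?j * (F ?j * F i * F ?j) + E ?j * (E i * F i) * F ?j"
    by (simp add: algebra_simps)
  also have "eqv \<nu> \<dots> (E i * F ?j * E ?j * F i + E ?j * 1 * F ?j)"
  proof (intro eqv_add EEEFFF_eqv assms eqv_context)
    let ?\<mu> = "shift (GenF ?j) \<nu>"
    show "leads (F ?j) \<nu> ?\<mu>" by (rule leads_intros)+
    show "eqv ?\<mu> (E i * F i) 1"
      using EF_eqv_scalar[of i ?\<mu>] assms by (simp add: scalar_simps)
  qed
  finally show ?thesis by simp
qed

text \<open>Expand (a - x)(a - y)(a - x) with a = 1/q. By x x = [2] x and a [2] = 1 + a a, the
  result is symmetric in x and y except for the last term - (x y x - x), which the two cubic
  computations show to be symmetric as well.\<close>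

lemma crossing_braid_relation:
  assumes "1 \<le> i" "Suc i < k" "\<nu> i = 1" "\<nu> (Suc i) = 1" "\<nu> (Suc (Suc i)) = 1"
  shows "eqv \<nu> (braid_image [(i, True), (Suc i, True), (i, True)])
    (braid_image [(Suc i, True), (i, True), (Suc i, True)])"
proof -
  define e where "e = E i * F i"
  define e' where "e' = E (Suc i) * F (Suc i)"
  define a where "a = scalar (inverse q)"
  define c where "c = scalar (q + inverse q)"
  have a: "x * a = a * x" "x * (a * y) = a * (x * y)" for x y
    unfolding a_def by (rule scalar_central scalar_left_commute)+
  have "eqv \<nu> (e * e' * e - e) (E i * F (Suc i) * E (Suc i) * F i + E i * F i - E i * F i)"
    unfolding e_def e'_def by (intro eqv_diff EF_EF_EF_up assms eqv_refl)
  also have "eqv \<nu> \<dots>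
      (E i * F (Suc i) * E (Suc i) * F i + E (Suc i) * F (Suc i) - E (Suc i) * F (Suc i))"
    by simp
  also have "eqv \<nu> \<dots> (e' * e * e' - e')"
    unfolding e_def e'_def by (intro eqv_diff eqv_sym[OF EF_EF_EF_down] assms eqv_refl)
  finally have braid: "eqv \<nu> (e * e' * e - e) (e' * e * e' - e')" .
  have sq: "eqv \<nu> (e * e) (c * e)" "eqv \<nu> (e' * e') (c * e')"
    unfolding e_def e'_def c_def using assms by (auto intro: EF_square)
  have ac: "a * c = 1 + a * a"
    unfolding a_def c_def
    by (simp add: distrib_left flip: scalar_simps(2,3,6))
  have *: "eqv \<nu> (a * a * a - a * a * x - a * a * y - a * a * x + a * (x * y) + a * (x * x) + a * (y * x)
        - x * y * x)
      (a * a * a - a * a * x - a * a * y - a * a * x + a * (x * y) + a * (c * x) + a * (y * x)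
        - x * y * x)" if "eqv \<nu> (x * x) (c * x)" for x y
    using that by (intro eqv_add eqv_diff eqv_left) auto
  have **: "(a - x) * (a - y) * (a - x)
      = a * a * a - a * a * x - a * a * y - a * a * x + a * (x * y) + a * (x * x) + a * (y * x)
        - x * y * x" for x y
    by (simp add: algebra_simps a(1)[of x] a(1)[of y] a(2)[of x] a(2)[of y])
  have ***: "a * a * a - a * a * x - a * a * y - a * a * x + a * (x * y) + a * (c * x) + a * (y * x)
        - x * y * x
      = a * a * a - a * a * x - a * a * y + a * (x * y) + a * (y * x) - (x * y * x - x)" for x y
  proof -
    have "a * (c * x) = x + a * a * x"
      using ac by (simp add: distrib_right flip: mult.assoc)
    then show ?thesis by simp
  qed
  have "eqv \<nu> ((a - e) * (a - e') * (a - e))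
      (a * a * a - a * a * e - a * a * e' + a * (e * e') + a * (e' * e) - (e * e' * e - e))"
    using *[OF sq(1), of e'] unfolding ** *** .
  also have "eqv \<nu> \<dots>
      (a * a * a - a * a * e - a * a * e' + a * (e * e') + a * (e' * e) - (e' * e * e' - e'))"
    by (intro eqv_diff braid eqv_refl)
  also have "\<dots> = a * a * a - a * a * e' - a * a * e + a * (e' * e) + a * (e * e') - (e' * e * e' - e')"
    by (simp add: algebra_simps)
  also have "eqv \<nu> \<dots> ((a - e') * (a - e) * (a - e'))"
    using eqv_sym[OF *[OF sq(2), of e]] unfolding ** *** .
  finally show ?thesis
    by (simp add: braid_image_Cons a_def e_def e'_def mult.assoc)
qed

end


section \<open>Partial closure\<close>

text \<open>Net effect of a run of consecutive E's or F's, in whatever order: the intermediate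
  entries telescope and one unit goes from b to a. This keeps weights in closed form instead of as
  nested shifts.\<close>

definition transfer :: "nat \<Rightarrow> nat \<Rightarrow> weight \<Rightarrow> weight"
  where "transfer a b \<nu> = (\<lambda>i. \<nu> i + (if i = a then 1 else 0) - (if i = b then 1 else 0))"

lemma transfer_transfer [simp]:
  "transfer a b (transfer b c \<nu>) = transfer a c \<nu>" "transfer b c (transfer a b \<nu>) = transfer a c \<nu>"
  by (auto simp: transfer_def fun_eq_iff)

lemma transfer_self [simp]: "transfer a a \<nu> = \<nu>"
  by (auto simp: transfer_def fun_eq_iff)

lemma leads_E_transfer: "leads (E i) \<nu> (transfer i (Suc i) \<nu>)"
  and leads_F_transfer: "leads (F i) \<nu> (transfer (Suc i) i \<nu>)"
proof -
  have "shift (GenE i) \<nu> = transfer i (Suc i) \<nu>" "shift (GenF i) \<nu> = transfer (Suc i) i \<nu>"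
    by (auto simp: transfer_def fun_eq_iff)
  then show "leads (E i) \<nu> (transfer i (Suc i) \<nu>)" "leads (F i) \<nu> (transfer (Suc i) i \<nu>)"
    using leads_E[of i \<nu>] leads_F[of i \<nu>] by metis+
qed

lemma Es_simps: "Es [] = 1" "Es (i # is) = E i * Es is" "Es (is @ js) = Es is * Es js"
  and Fs_simps: "Fs [] = 1" "Fs (i # is) = F i * Fs is" "Fs (is @ js) = Fs is * Fs js"
  by (simp_all add: Es_def Fs_def)

lemma leads_interval:
  assumes "a \<le> c"
  shows "leads (Es [a..<c]) \<nu> (transfer a c \<nu>)" "leads (Es (rev [a..<c])) \<nu> (transfer a c \<nu>)"
    "leads (Fs [a..<c]) \<nu> (transfer c a \<nu>)" "leads (Fs (rev [a..<c])) \<nu> (transfer c a \<nu>)"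
  using assms
proof (induction c arbitrary: \<nu> rule: dec_induct)
  case base
  { case 1 show ?case by (simp add: Es_simps leads_one) }
  { case 2 show ?case by (simp add: Es_simps leads_one) }
  { case 3 show ?case by (simp add: Fs_simps leads_one) }
  { case 4 show ?case by (simp add: Fs_simps leads_one) }
next
  case (step n)
  { case 1 show ?case
      using leads_mult[OF step.IH(1) leads_E_transfer[of n \<nu>]] step.hyps by (simp add: Es_simps) }
  { case 2 show ?case
      using leads_mult[OF leads_E_transfer[of n] step.IH(2)[of \<nu>]] step.hyps by (simp add: Es_simps) }
  { case 3 show ?case
      using leads_mult[OF step.IH(3) leads_F_transfer[of n \<nu>]] step.hyps by (simp add: Fs_simps) }
  { case 4 show ?case
      using leads_mult[OF leads_F_transfer[of n] step.IH(4)[of \<nu>]] step.hyps by (simp add: Fs_simps) }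
qed

lemma homogeneous_Es: "homogeneous (Es is)" and homogeneous_Fs: "homogeneous (Fs is)"
  by (auto simp: Es_def Fs_def intro!: homogeneous_prod_list homogeneous_E homogeneous_F)

lemma homogeneous_D_star: "homogeneous (D_star k s)"
  unfolding D_star_def by (intro homogeneous_mult homogeneous_Es homogeneous_E)

context doubled_schur
begin

lemma commutes_step:
  assumes "a = u * (x * y) * v" and "b = u * (y * x) * v" and "commutes x y" and "homogeneous v"
  shows "eqv \<nu> a b"
proof -
  obtain \<mu> where "leads v \<nu> \<mu>" using assms(4) by (auto simp: homogeneous_def)
  then show ?thesis
    using assms by (auto simp: commutes_def intro: eqv_context)
qed

lemma commutes_Es: "(\<And>i. i \<in> set is \<Longrightarrow> commutes x (E i)) \<Longrightarrow> commutes x (Es is)"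
  and commutes_Fs: "(\<And>i. i \<in> set is \<Longrightarrow> commutes x (F i)) \<Longrightarrow> commutes x (Fs is)"
  unfolding Es_def Fs_def by (auto intro!: commutes_prod_list homogeneous_E homogeneous_F)

lemma FE_eqv_one:
  assumes "1 \<le> i" "i < k + l" "i \<le> k \<and> \<nu> i = 0 \<or> k \<le> i \<and> \<nu> (Suc i) = \<beta>" "\<nu> (Suc i) = \<nu> i + 1"
  shows "eqv \<nu> (F i * E i) 1"
  using FE_eqv[OF assms(1-3)] assms(4) by (simp add: scalar_simps)

lemma EF_eqv_one:
  assumes "1 \<le> i" "i < k + l" "i < k \<and> \<nu> (Suc i) = 0 \<or> k < i \<and> \<nu> i = \<beta>" "\<nu> i = \<nu> (Suc i) + 1"
  shows "eqv \<nu> (E i * F i) 1"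
  using EF_eqv_scalar[OF assms(1-3)] assms(4) by (simp add: scalar_simps)

text \<open>The unit at c is carried to a through zeros and back. The innermost F_a E_a meets the
  entries (0, 1), where it is 1, so the product collapses from the inside.\<close>

lemma Fs_Es_eqv_one:
  assumes "1 \<le> a" "a \<le> c" "c \<le> k" "\<And>i. a \<le> i \<Longrightarrow> i < c \<Longrightarrow> \<nu> i = 0" "\<nu> c = 1"
  shows "eqv \<nu> (Fs (rev [a..<c]) * Es [a..<c]) 1"
  using assms(2,1,4)
proof (induction a rule: inc_induct)
  case base
  show ?case by (simp add: Es_simps Fs_simps)
next
  case (step a)
  let ?\<mu> = "transfer (Suc a) c \<nu>"
  have upt: "[a..<c] = a # [Suc a..<c]" using step.hyps by (intro upt_conv_Cons) simp
  have "eqv \<nu> (Fs (rev [a..<c]) * Es [a..<c]) (Fs (rev [Suc a..<c]) * 1 * Es [Suc a..<c])"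
  proof (rule eqv_step[where u = "Fs (rev [Suc a..<c])" and x = "F a * E a" and v = "Es [Suc a..<c]"])
    show "leads (Es [Suc a..<c]) \<nu> ?\<mu>" using step by (intro leads_interval) auto
    show "eqv ?\<mu> (F a * E a) 1"
      using step assms by (intro FE_eqv_one; cases "Suc a = c") (auto simp: transfer_def)
  qed (simp_all add: upt Es_simps Fs_simps mult.assoc)
  also have "eqv \<nu> \<dots> 1" using step by simp
  finally show ?case .
qed

text \<open>Counterpart on the right half: what travels is the deficit \<beta> - 1 among entries
  \<beta>, and the E's move it to the right.\<close>

lemma Fs_Es_eqv_one_right:
  assumes "k < a" "a \<le> c" "c \<le> k + l" "\<And>i. a < i \<Longrightarrow> i \<le> c \<Longrightarrow> \<nu> i = \<beta>" "\<nu> a = \<beta> - 1"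
  shows "eqv \<nu> (Fs [a..<c] * Es (rev [a..<c])) 1"
  using assms(2,3,4)
proof (induction rule: dec_induct)
  case base
  show ?case by (simp add: Es_simps Fs_simps)
next
  case (step c)
  let ?\<mu> = "transfer a c \<nu>"
  have "eqv \<nu> (Fs [a..<Suc c] * Es (rev [a..<Suc c])) (Fs [a..<c] * 1 * Es (rev [a..<c]))"
  proof (rule eqv_step[where u = "Fs [a..<c]" and x = "F c * E c" and v = "Es (rev [a..<c])"])
    show "leads (Es (rev [a..<c])) \<nu> ?\<mu>" using step by (intro leads_interval) auto
    show "eqv ?\<mu> (F c * E c) 1"
      using step assms by (intro FE_eqv_one; cases "a = c") (auto simp: transfer_def)
  qed (use step in \<open>simp_all add: Es_simps Fs_simps mult.assoc\<close>)
  also have "eqv \<nu> \<dots> 1" using step by simp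
  finally show ?case .
qed

lemma Es_Fs_eqv_one:
  assumes "1 \<le> a" "a \<le> c" "c \<le> k" "\<And>i. a < i \<Longrightarrow> i \<le> c \<Longrightarrow> \<nu> i = 0" "\<nu> a = 1"
  shows "eqv \<nu> (Es [a..<c] * Fs (rev [a..<c])) 1"
  using assms(2,3,4)
proof (induction rule: dec_induct)
  case base
  show ?case by (simp add: Es_simps Fs_simps)
next
  case (step c)
  let ?\<mu> = "transfer c a \<nu>"
  have "eqv \<nu> (Es [a..<Suc c] * Fs (rev [a..<Suc c])) (Es [a..<c] * 1 * Fs (rev [a..<c]))"
  proof (rule eqv_step[where u = "Es [a..<c]" and x = "E c * F c" and v = "Fs (rev [a..<c])"])
    show "leads (Fs (rev [a..<c])) \<nu> ?\<mu>" using step by (intro leads_interval) auto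
    show "eqv ?\<mu> (E c * F c) 1"
      using step assms by (intro EF_eqv_one; cases "a = c") (auto simp: transfer_def)
  qed (use step in \<open>simp_all add: Es_simps Fs_simps mult.assoc\<close>)
  also have "eqv \<nu> \<dots> 1" using step by simp
  finally show ?case .
qed

text \<open>E_a and F_a slide outwards past all other letters. This leaves F_{a+1} E_{a+1} at the
  entries (1, 1), where the commutator is [0] = 0 and the order may be swapped; the same situation
  then recurs with a + 1 in place of a, the unit having moved one step right.\<close>

lemma Fs_EF_Es_eqv:
  assumes "1 \<le> a" "a < c" "c \<le> k" "c < k + l" "\<And>i. a < i \<Longrightarrow> i < c \<Longrightarrow> \<nu> i = 0" "\<nu> a = 1" "\<nu> c = 1"
  shows "eqv \<nu> (Fs (rev [Suc a..<c]) * (E a * F a) * Es [Suc a..<c]) (Es [a..<c] * Fs (rev [a..<c]))"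
proof -
  from assms(2) have "a \<le> c - 1" by simp
  from this assms(1,5,6,7) show ?thesis
  proof (induction a arbitrary: \<nu> rule: inc_induct)
    case base
    have "[c - 1..<c] = [c - 1]" using assms(2) by (cases c) simp_all
    then show ?case using assms(2) by (simp add: Es_simps Fs_simps)
  next
    case (step a)
    let ?L = "Fs (rev [Suc a..<c])" and ?L' = "Es [Suc a..<c]"
    let ?M = "Fs (rev [Suc (Suc a)..<c])" and ?M' = "Es [Suc (Suc a)..<c]"
    let ?\<mu> = "transfer (Suc a) a \<nu>"
    have upt: "[a..<c] = a # [Suc a..<c]" "[Suc a..<c] = Suc a # [Suc (Suc a)..<c]"
      using step.hyps by (intro upt_conv_Cons; simp)+
    have "eqv \<nu> (?L * (E a * F a) * ?L') (1 * (E a * ?L) * (F a * ?L'))"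
    proof (rule commutes_step[where u = 1 and v = "F a * ?L'" and x = ?L and y = "E a"])
      show "commutes ?L (E a)"
        using step assms by (intro commutes_sym[OF commutes_Fs] commutes_EF) auto
    qed (auto simp: mult.assoc intro: homogeneous_mult homogeneous_F homogeneous_Es)
    also have "eqv \<nu> \<dots> (E a * ?L * (?L' * F a) * 1)"
    proof (rule commutes_step[where u = "E a * ?L" and v = 1 and x = "F a" and y = ?L'])
      show "commutes (F a) ?L'"
        using step assms by (intro commutes_Es commutes_FE) auto
    qed (auto simp: mult.assoc homogeneous_one)
    also have "\<dots> = E a * ?M * (F (Suc a) * E (Suc a)) * (?M' * F a)"
      by (simp add: upt(2) Es_simps Fs_simps mult.assoc)
    also have "eqv \<nu> \<dots> (E a * ?M * (E (Suc a) * F (Suc a)) * (?M' * F a))"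
    proof (rule eqv_context)
      let ?\<kappa> = "transfer (Suc (Suc a)) c ?\<mu>"
      show "leads (?M' * F a) \<nu> ?\<kappa>"
        using step by (intro leads_mult[OF leads_interval(1) leads_F_transfer]) auto
      have "?\<kappa> (Suc a) = 1 \<and> ?\<kappa> (Suc (Suc a)) = 1"
        using step by (cases "Suc (Suc a) = c") (auto simp: transfer_def)
      then have "eqv ?\<kappa> (E (Suc a) * F (Suc a)) (F (Suc a) * E (Suc a) + scalar (qint (1 - 1)))"
        using EF_eqv[of "Suc a" ?\<kappa>] step assms by auto
      then show "eqv ?\<kappa> (F (Suc a) * E (Suc a)) (E (Suc a) * F (Suc a))"
        using eqv_sym by (simp add: scalar_simps)
    qed
    also have "\<dots> = E a * (?M * (E (Suc a) * F (Suc a)) * ?M') * F a"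
      by (simp add: mult.assoc)
    also have "eqv \<nu> \<dots> (E a * (Es [Suc a..<c] * Fs (rev [Suc a..<c])) * F a)"
      using step by (intro eqv_context[OF leads_F_transfer] step.IH) (auto simp: transfer_def)
    finally show ?case by (simp add: upt(1) Es_simps Fs_simps mult.assoc)
  qed
qed

end

section \<open>Closing one strand at \<beta> = 0\<close>

locale doubled_schur_zero = doubled_schur 0 k "k - 1" for k
begin

context
  fixes s :: nat and \<nu> :: weight
  assumes s: "1 \<le> s" "s < k" and zero: "\<And>i. k - s < i \<Longrightarrow> i \<le> k + s \<Longrightarrow> \<nu> i = 0"
begin

text \<open>The weight between the right and the left arm of \<open>D_star\<close>, where the left
  arms of cap and cup are evaluated against each other.\<close>

lemma leads_cups:
  "leads (Es (rev [k+1..<k+s]) * E k) \<nu> (transfer k (k + s) \<nu>)"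
proof -
  have "leads (Es (rev [k+1..<k+s]) * E k) \<nu> (transfer (k + 1) (k + s) (transfer k (Suc k) \<nu>))"
    using s by (intro leads_mult[OF leads_interval(2) leads_E_transfer]) auto
  then show ?thesis by simp
qed

lemma right_arcs_eqv_one:
  "eqv (transfer k (Suc k) \<nu>) (Fs [k+1..<k+s] * Es (rev [k+1..<k+s])) 1"
  using s zero by (intro Fs_Es_eqv_one_right) (auto simp: transfer_def)

text \<open>The left arms retract, then the right ones, until only F_k E_k at the entries (0, 0)
  remains.\<close>

lemma D_D_star: "eqv \<nu> (D k s * D_star k s) 0"
proof -
  have "eqv \<nu> (D k s * D_star k s) (F k * Fs [k+1..<k+s] * 1 * (Es (rev [k+1..<k+s]) * E k))"
  proof (rule eqv_step[where u = "F k * Fs [k+1..<k+s]" and v = "Es (rev [k+1..<k+s]) * E k"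
        and x = "Fs (rev [k-s+1..<k]) * Es [k-s+1..<k]", OF _ refl leads_cups])
    show "eqv (transfer k (k + s) \<nu>) (Fs (rev [k-s+1..<k]) * Es [k-s+1..<k]) 1"
      using s zero by (intro Fs_Es_eqv_one) (auto simp: transfer_def)
  qed (simp add: D_def D_star_def mult.assoc)
  also have "eqv \<nu> \<dots> (F k * 1 * E k)"
    by (rule eqv_step[where u = "F k" and x = "Fs [k+1..<k+s] * Es (rev [k+1..<k+s])" and v = "E k",
          OF _ refl leads_E_transfer right_arcs_eqv_one])
      (simp add: mult.assoc)
  also have "eqv \<nu> \<dots> 0"
    using FE_eqv[of k \<nu>] s zero[of k] zero[of "Suc k"] by (auto simp: scalar_simps)
  finally show ?thesis .
qed

text \<open>The value is that of F_k E_k at the entries (1, 0), namely - [1]: the strand at k - s is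
  carried to position k, meets the cup there, and is carried back. As E_i F_i enters a crossing with
  a minus sign, the crossing closes up to +1.\<close>

lemma D_EF_D_star:
  assumes "\<nu> (k - s) = 1"
  shows "eqv \<nu> (D k s * (E (k - s) * F (k - s)) * D_star k s) (- 1)"
proof -
  define a where "a = k - s"
  have a: "1 \<le> a" "a < k" "Suc a = k - s + 1" using s by (auto simp: a_def)
  let ?L = "Fs (rev [k-s+1..<k])" and ?L' = "Es [k-s+1..<k]"
  let ?R = "Fs [k+1..<k+s]" and ?R' = "Es (rev [k+1..<k+s])"
  let ?A = "Es [a..<k]" and ?B = "Fs (rev [a..<k])"
  have "eqv \<nu> (D k s * (E a * F a) * D_star k s) (F k * ?R * (?A * ?B) * (?R' * E k))"
  proof (rule eqv_step[where x = "?L * (E a * F a) * ?L'" and u = "F k * ?R", OF _ refl leads_cups])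
    show "eqv (transfer k (k + s) \<nu>) (?L * (E a * F a) * ?L') (?A * ?B)"
      unfolding a(3)[symmetric] using s zero assms
      by (intro Fs_EF_Es_eqv) (auto simp: transfer_def a_def)
  qed (simp add: D_def D_star_def mult.assoc)
  \<comment> \<open>\<open>?A * ?B\<close> separates the two right arms. Its indices are below k and
    those of the arms above k, so it can be moved out of the way and the arms cancel.\<close>
  also have "eqv \<nu> \<dots> (F k * (?A * ?B * ?R) * (?R' * E k))"
  proof (rule commutes_step[where u = "F k" and x = ?R and y = "?A * ?B" and v = "?R' * E k"])
    show "commutes ?R (?A * ?B)"
      using s a by (intro commutes_mult commutes_Es commutes_Fs homogeneous_Fs
          commutes_sym[OF commutes_Fs] commutes_EF commutes_FF) auto
  qed (auto simp: mult.assoc intro: homogeneous_mult homogeneous_Es homogeneous_E)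
  also have "eqv \<nu> \<dots> (F k * (?A * ?B) * 1 * E k)"
    by (rule eqv_step[where u = "F k * (?A * ?B)" and x = "?R * ?R'" and v = "E k",
          OF _ refl leads_E_transfer right_arcs_eqv_one])
      (simp add: mult.assoc)
  also have "eqv \<nu> \<dots> (1 * (?A * F k) * (?B * E k))"
  proof (rule commutes_step[where u = 1 and x = "F k" and y = ?A and v = "?B * E k"])
    show "commutes (F k) ?A"
      using s a by (intro commutes_Es commutes_FE) auto
  qed (auto simp: mult.assoc intro: homogeneous_mult homogeneous_Fs homogeneous_E)
  also have "eqv \<nu> \<dots> (?A * F k * (E k * ?B) * 1)"
  proof (rule commutes_step[where u = "?A * F k" and x = ?B and y = "E k" and v = 1])
    show "commutes ?B (E k)"
      using s a by (intro commutes_sym[OF commutes_Fs] commutes_EF) auto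
  qed (auto simp: mult.assoc homogeneous_one)
  also have "eqv \<nu> \<dots> (?A * (- 1) * ?B)"
  proof (rule eqv_step[where u = ?A and x = "F k * E k" and v = ?B, OF _ refl leads_interval(4)])
    show "eqv (transfer k a \<nu>) (F k * E k) (- 1)"
      using FE_eqv[of k "transfer k a \<nu>"] s a zero[of k] zero[of "Suc k"]
      by (auto simp: transfer_def scalar_simps)
  qed (use a in \<open>auto simp: mult.assoc\<close>)
  also have "eqv \<nu> \<dots> (0 - 1)"
    using eqv_diff[OF eqv_refl Es_Fs_eqv_one[of a k \<nu>], of 0] assms a zero s by (auto simp: a_def)
  finally show ?thesis by (simp add: a_def)
qed

lemma D_crossing_D_star:
  assumes "\<nu> (k - s) = 1"
  shows "eqv \<nu> (D k s * braid_image [(k - s, t)] * D_star k s) 1"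
proof -
  let ?c = "scalar (if t then inverse q else q)"
  have "D k s * braid_image [(k - s, t)] * D_star k s
      = ?c * (D k s * D_star k s) - D k s * (E (k - s) * F (k - s)) * D_star k s"
    by (simp add: braid_image_Cons algebra_simps scalar_left_commute[symmetric])
  also have "eqv \<nu> \<dots> (?c * 0 - - 1)"
    by (intro eqv_diff eqv_left D_D_star D_EF_D_star assms)
  finally show ?thesis by simp
qed

end

text \<open>A braid on k - s strands has indices below k - s, the arc of index s only letters above
  k - s; the gap makes all of them commute.\<close>

lemma
  assumes "1 \<le> s" "s < k" "is_braid (k - s) b"
  shows D_commutes: "commutes (D k s) (braid_image b)"
    and D_star_commutes: "commutes (D_star k s) (braid_image b)"
proof -
  have i: "1 \<le> i" "Suc i < k - s + 1" "Suc i < k" if "(i, t) \<in> set b" for i t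
    using that assms by (auto simp: is_braid_def)
  show "commutes (D k s) (braid_image b)"
  proof (rule commutes_braid_image)
    fix i t assume it: "(i, t) \<in> set b"
    have "commutes (E i * F i) (D k s)"
      unfolding D_def using i[OF it] assms
      by (intro commutes_mult commutes_Fs homogeneous_Fs commutes_sym[OF commutes_EF_pair(2)]) auto
    then show "commutes (D k s) (E i * F i)" by (rule commutes_sym)
  qed
  show "commutes (D_star k s) (braid_image b)"
  proof (rule commutes_braid_image)
    fix i t assume it: "(i, t) \<in> set b"
    have "commutes (E i * F i) (D_star k s)"
      unfolding D_star_def using i[OF it] assms
      by (intro commutes_mult commutes_Es homogeneous_Es homogeneous_E
          commutes_sym[OF commutes_EF_pair(1)]) auto
    then show "commutes (D_star k s) (E i * F i)" by (rule commutes_sym)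
  qed
qed

end


section \<open>Reduction to normal forms in the Hecke algebra\<close>

lemma is_braid_simps [simp]:
  "is_braid m []" "is_braid m ((i, s) # b) \<longleftrightarrow> 1 \<le> i \<and> i < m \<and> is_braid m b"
  "is_braid m (b @ c) \<longleftrightarrow> is_braid m b \<and> is_braid m c"
  by (auto simp: is_braid_def)

lemma is_braid_mono: "is_braid m b \<Longrightarrow> m \<le> n \<Longrightarrow> is_braid n b"
  by (fastforce simp: is_braid_def)

text \<open>Stability of a set of braid words under the Hecke relations, in the form satisfied by
  the set where two functions that respect these relations agree. The skein, inverse and braid
  clauses build up words: they lead to the other sign, to a longer word, or to one with more letters
  of the higher index. Negative letters are reached through the skein clause, so the braid clause
  speaks of positive ones.\<close>

definition hecke_closed :: "nat \<Rightarrow> (braid \<Rightarrow> bool) \<Rightarrow> bool"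
  where "hecke_closed m P \<longleftrightarrow>
    (\<forall>u v i s. is_braid m u \<and> is_braid m v \<and> 1 \<le> i \<and> i < m \<longrightarrow>
      (P (u @ v) \<longrightarrow> P (u @ (i, s) # v) \<longrightarrow> P (u @ (i, \<not> s) # v)) \<and>
      (P (u @ v) \<longrightarrow> P (u @ (i, s) # (i, \<not> s) # v)) \<and>
      (Suc i < m \<longrightarrow> P (u @ (i, True) # (Suc i, True) # (i, True) # v) \<longrightarrow>
        P (u @ (Suc i, True) # (i, True) # (Suc i, True) # v)) \<and>
      (\<forall>j t. 1 \<le> j \<and> Suc j < i \<longrightarrow>
        (P (u @ (i, s) # (j, t) # v) \<longleftrightarrow> P (u @ (j, t) # (i, s) # v))))"

lemma
  assumes "hecke_closed m P" "is_braid m u" "is_braid m v" "1 \<le> i" "i < m"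
  shows hecke_skein: "P (u @ v) \<Longrightarrow> P (u @ (i, s) # v) \<Longrightarrow> P (u @ (i, \<not> s) # v)"
    and hecke_inverse: "P (u @ v) \<Longrightarrow> P (u @ (i, s) # (i, \<not> s) # v)"
    and hecke_braid: "Suc i < m \<Longrightarrow> P (u @ (i, True) # (Suc i, True) # (i, True) # v) \<Longrightarrow>
      P (u @ (Suc i, True) # (i, True) # (Suc i, True) # v)"
    and hecke_far: "1 \<le> j \<Longrightarrow> Suc j < i \<Longrightarrow>
      P (u @ (i, s) # (j, t) # v) \<longleftrightarrow> P (u @ (j, t) # (i, s) # v)"
  using assms unfolding hecke_closed_def by blast+

text \<open>Makes a statement about fewer strands applicable to a factor in the middle of a
  word.\<close>

lemma hecke_closed_context:
  assumes "hecke_closed m P" "n \<le> m" "is_braid m a" "is_braid m c"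
  shows "hecke_closed n (\<lambda>x. P (a @ x @ c))"
  unfolding hecke_closed_def
proof (intro allI impI, elim conjE)
  fix u v :: braid and i :: nat and s :: bool
  assume *: "is_braid n u" "is_braid n v" "1 \<le> i" "i < n"
  then have **: "is_braid m (a @ u)" "is_braid m (v @ c)" "1 \<le> i" "i < m"
    using assms is_braid_mono[of n _ m] by auto
  show "(P (a @ (u @ v) @ c) \<longrightarrow> P (a @ (u @ (i, s) # v) @ c) \<longrightarrow> P (a @ (u @ (i, \<not> s) # v) @ c)) \<and>
      (P (a @ (u @ v) @ c) \<longrightarrow> P (a @ (u @ (i, s) # (i, \<not> s) # v) @ c)) \<and>
      (Suc i < n \<longrightarrow> P (a @ (u @ (i, True) # (Suc i, True) # (i, True) # v) @ c) \<longrightarrow>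
        P (a @ (u @ (Suc i, True) # (i, True) # (Suc i, True) # v) @ c)) \<and>
      (\<forall>j t. 1 \<le> j \<and> Suc j < i \<longrightarrow>
        P (a @ (u @ (i, s) # (j, t) # v) @ c) = P (a @ (u @ (j, t) # (i, s) # v) @ c))"
    using hecke_skein[OF assms(1) **, of s] hecke_inverse[OF assms(1) **, of s]
      hecke_braid[OF assms(1) **] hecke_far[OF assms(1) **, of _ s] assms(2)
    by auto
qed

lemma hecke_far_word:
  assumes "hecke_closed m P" "is_braid m u" "is_braid m v" "is_braid (i - 1) x" "1 \<le> i" "i < m"
  shows "P (u @ (i, s) # x @ v) \<longleftrightarrow> P (u @ x @ (i, s) # v)"
  using assms(2,4)
proof (induction x arbitrary: u)
  case (Cons c x)
  obtain j t where c: "c = (j, t)" by (cases c)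
  have j: "1 \<le> j" "Suc j < i" "is_braid m x" "is_braid (i - 1) x"
    using Cons.prems assms(6) is_braid_mono[of "i - 1" x m] by (auto simp: c)
  have "P (u @ (i, s) # (j, t) # (x @ v)) \<longleftrightarrow> P (u @ (j, t) # (i, s) # (x @ v))"
    using assms j Cons.prems by (intro hecke_far) auto
  also have "\<dots> \<longleftrightarrow> P (u @ (j, t) # x @ (i, s) # v)"
    using Cons.IH[of "u @ [(j, t)]"] j Cons.prems assms by auto
  finally show ?case by (simp add: c)
qed simp

text \<open>A word with two letters \<open>\<sigma>\<^sub>m\<^sup>\<plusminus>\<^sup>1\<close> reduces to words with fewer of them: by induction on \<open>m\<close>,
  the word between two consecutive ones may be taken of the form \<open>x\<close> or
  \<open>x \<sigma>\<^sub>m\<^sub>-\<^sub>1 y\<close>, where \<open>x\<close> and \<open>y\<close> commute with \<open>\<sigma>\<^sub>m\<close>.\<close>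

theorem hecke_normal_form:
  assumes "hecke_closed (Suc m) P"
    and "\<And>x. is_braid m x \<Longrightarrow> P x"
    and "\<And>x y. 1 \<le> m \<Longrightarrow> is_braid m x \<Longrightarrow> is_braid m y \<Longrightarrow> P (x @ (m, True) # y)"
    and "is_braid (Suc m) w"
  shows "P w"
  using assms
proof (induction m arbitrary: P w)
  case 0
  then show ?case by (cases w) (auto simp: is_braid_def)
next
  case (Suc m')
  define m where "m = Suc m'"
  note closed = Suc.prems(1)[folded m_def]
  \<comment> \<open>Measure of the inner induction: the number of letters of top index m. The outer
    induction handles the word between two such letters.\<close>
  define cnt :: "braid \<Rightarrow> nat" where "cnt b = length (filter (\<lambda>c. fst c = m) b)" for b
  have split: "\<exists>x s y. b = x @ (m, s) # y \<and> is_braid m x \<and> is_braid (Suc m) y \<and> cnt b = Suc (cnt y)"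
    if "is_braid (Suc m) b" "\<not> is_braid m b" for b
    using that
  proof (induction b)
    case (Cons c b)
    obtain i t where c: "c = (i, t)" by (cases c)
    show ?case
    proof (cases "i = m")
      case True
      then show ?thesis using Cons.prems
        by (intro exI[of _ "[]"] exI[of _ t] exI[of _ b]) (auto simp: c cnt_def)
    next
      case False
      then obtain x s y where "b = x @ (m, s) # y" "is_braid m x" "is_braid (Suc m) y"
          "cnt b = Suc (cnt y)"
        using Cons by (auto simp: c)
      then show ?thesis using False Cons.prems
        by (intro exI[of _ "c # x"] exI[of _ s] exI[of _ y]) (auto simp: c cnt_def)
    qed
  qed simp
  have up: "is_braid (Suc m) x" if "is_braid m x" for x
    using that by (rule is_braid_mono) simp
  have cnt_append: "cnt (x @ y) = cnt x + cnt y" for x y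
    by (simp add: cnt_def)
  have cnt_Cons: "cnt ((i, s) # x) = (if i = m then Suc (cnt x) else cnt x)" for i s x
    by (simp add: cnt_def)
  have cnt_0: "cnt x = 0" if "is_braid m x" for x
    using that by (auto simp: cnt_def is_braid_def filter_empty_conv)
  show ?case using Suc.prems(4)[folded m_def]
  proof (induction "cnt w" arbitrary: w rule: less_induct)
    case less
    have signs: "P (u @ (m, s) # v)"
      if "P (u @ v)" "P (u @ (m, True) # v)" "is_braid (Suc m) u" "is_braid (Suc m) v" for u v s
      using that hecke_skein[OF closed that(3,4), of m True] by (cases s) (auto simp: m_def)
    show "P w"
    proof (cases "is_braid m w")
      case True
      then show ?thesis by (rule Suc.prems(2)[folded m_def])
    next
      case False
      then obtain u s w' where w: "w = u @ (m, s) # w'" "is_braid m u" "is_braid (Suc m) w'"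
          "cnt w = Suc (cnt w')"
        using split less.prems by blast
      have "P (u @ w')"
        using w up by (intro less.hyps) (auto simp: cnt_append cnt_0)
      moreover have "P (u @ (m, True) # w')"
      proof (cases "is_braid m w'")
        case True
        then show ?thesis using Suc.prems(3)[folded m_def] w by (simp add: m_def)
      next
        case False
        then obtain x t v where w': "w' = x @ (m, t) # v" "is_braid m x" "is_braid (Suc m) v"
            "cnt w' = Suc (cnt v)"
          using split w by blast
        have fewer: "P (u @ y @ v)" if "is_braid (Suc m) y" "cnt y \<le> 1" for y
          using that w w' up by (intro less.hyps) (auto simp: cnt_append cnt_0)
        have far: "P (a @ (m, True) # z @ b) \<longleftrightarrow> P (a @ z @ (m, True) # b)"
          if "is_braid (Suc m) a" "is_braid (Suc m) b" "is_braid m' z" for a b z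
          using that by (intro hecke_far_word[OF closed]) (auto simp: m_def)
        \<comment> \<open>The outer induction hypothesis is applied to a predicate in the factor x
          alone, with everything around it fixed.\<close>
        have "P ((u @ [(m, True)]) @ x @ (m, True) # v)"
        proof (rule Suc.IH[of "\<lambda>x. P ((u @ [(m, True)]) @ x @ (m, True) # v)"])
          show "hecke_closed (Suc m') (\<lambda>x. P ((u @ [(m, True)]) @ x @ (m, True) # v))"
            using w w' up by (intro hecke_closed_context[OF closed]) (auto simp: m_def)
          show "is_braid (Suc m') x" using w' by (simp add: m_def)
        next
          fix x assume x: "is_braid m' x"
          then have x': "is_braid (Suc m) x" by (rule is_braid_mono) (simp add: m_def)
          have cx: "cnt x = 0" using x by (intro cnt_0) (auto simp: m_def intro: is_braid_mono)
          \<comment> \<open>Once x is moved out, the two top letters form a square; the skein clause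
            obtains it from a cancelling pair and a single letter.\<close>
          have "P ((u @ x @ [(m, True)]) @ (m, False) # v)"
            using hecke_inverse[OF closed, of "u @ x" v m True] fewer[of x] x' cx w w' up
            by (auto simp: m_def)
          moreover have "P ((u @ x @ [(m, True)]) @ v)"
            using fewer[of "x @ [(m, True)]"] x' cx by (simp add: cnt_append cnt_Cons cnt_def m_def)
          ultimately have "P ((u @ x @ [(m, True)]) @ (m, True) # v)"
            using hecke_skein[OF closed, of "u @ x @ [(m, True)]" v m False] x' w w' up
            by (auto simp: m_def)
          then show "P ((u @ [(m, True)]) @ x @ (m, True) # v)"
            using far[of u "(m, True) # v" x] x w w' up by (auto simp: m_def)
        next
          fix x y assume 1: "1 \<le> m'" and xy: "is_braid m' x" "is_braid m' y"
          then have xy': "is_braid (Suc m) x" "is_braid (Suc m) y"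
            by (auto simp: m_def intro: is_braid_mono)
          have cxy: "cnt x = 0" "cnt y = 0"
            using xy by (auto simp: m_def intro!: cnt_0 intro: is_braid_mono)
          \<comment> \<open>Read backwards: x and y are moved out and m, m', m is traded for m', m,
            m', which contains one top letter fewer.\<close>
          have "P (u @ (x @ (m', True) # (m, True) # (m', True) # y) @ v)"
            using xy' cxy 1 by (intro fewer) (auto simp: cnt_append cnt_Cons m_def)
          then have "P ((u @ x) @ (m, True) # (m', True) # (m, True) # y @ v)"
            using hecke_braid[OF closed, of "u @ x" "y @ v" m'] xy' w w' up 1 by (auto simp: m_def)
          then have "P (u @ (m, True) # x @ (m', True) # (m, True) # y @ v)"
            using far[of u "(m', True) # (m, True) # y @ v" x] xy xy' w w' up 1 by (auto simp: m_def)
          then show "P ((u @ [(m, True)]) @ (x @ (m', True) # y) @ (m, True) # v)"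
            using far[of "u @ (m, True) # x @ [(m', True)]" v y] xy xy' w w' up 1
            by (auto simp: m_def)
        qed
        moreover have "P ((u @ (m, True) # x) @ v)"
          using fewer[of "(m, True) # x"] w' up by (auto simp: cnt_Cons cnt_0 m_def)
        ultimately show ?thesis
          using signs[of "u @ (m, True) # x" v t] w w' up by (auto simp: m_def)
      qed
      ultimately show ?thesis
        using signs w up by simp
    qed
  qed
qed


section \<open>Deformations of diagrams\<close>

lemma slice_simps [simp]:
  "\<not> slice (0, e) s t"
  "slice (Suc 0, Cross c) s t \<longleftrightarrow> (\<exists>a b v. s = a # b # v \<and> t = b # a # v)"
  "slice (Suc 0, Cup c) s t \<longleftrightarrow> t = c # (\<not> c) # s"
  "slice (Suc 0, Cap) s t \<longleftrightarrow> (\<exists>a. s = a # (\<not> a) # t)"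
  by (auto simp: slice.simps)

lemma slice_Cons: "slice (p, e) s t \<Longrightarrow> slice (Suc p, e) (a # s) (a # t)"
  by (auto simp: slice.simps) (metis append_Cons length_Cons)+

lemma slice_Suc_Suc [simp]:
  "slice (Suc (Suc p), e) s t \<longleftrightarrow> (\<exists>a s' t'. s = a # s' \<and> t = a # t' \<and> slice (Suc p, e) s' t')"
proof
  assume "slice (Suc (Suc p), e) s t"
  then show "\<exists>a s' t'. s = a # s' \<and> t = a # t' \<and> slice (Suc p, e) s' t'"
    by (auto simp: slice.simps Suc_length_conv) metis+
qed (auto intro: slice_Cons)

lemma tangle_simps [simp]:
  "tangle [] s t \<longleftrightarrow> s = t"
  "tangle (x # d) s t \<longleftrightarrow> (\<exists>r. tangle d s r \<and> slice x r t)"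
  by (subst tangle.simps; auto)+

lemma tangle_append: "tangle (d @ d') s t \<longleftrightarrow> (\<exists>r. tangle d' s r \<and> tangle d r t)"
  by (induction d arbitrary: t) auto

section \<open>Boundaries of local moves\<close>

definition refines :: "diagram \<Rightarrow> diagram \<Rightarrow> bool"
  where "refines m m' \<longleftrightarrow> (\<forall>s t. tangle m s t \<longrightarrow> tangle m' s t)"

text \<open>Adds a strand on the far left. Thus the boundaries of a local move have to be inspected
  at the lowest position only.\<close>

definition raise :: "diagram \<Rightarrow> diagram"
  where "raise d = map (\<lambda>(p, e). (Suc p, e)) d"

lemma tangle_raise: "tangle d s t \<Longrightarrow> tangle (raise d) (a # s) (a # t)"
  by (induction d arbitrary: t) (auto simp: raise_def intro: slice_Cons)

text \<open>The empty diagram is excluded because it also joins empty ends, which have no leftmost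
  strand. A slice at position 0 is illegal but would become legal when raised.\<close>

lemma tangle_raise_cases:
  assumes "tangle (raise d) s t" "d \<noteq> []" "\<forall>(p, e) \<in> set d. 1 \<le> p"
  shows "\<exists>a s' t'. s = a # s' \<and> t = a # t' \<and> tangle d s' t'"
  using assms
proof (induction d arbitrary: t)
  case (Cons x d)
  obtain p e where x: "x = (Suc p, e)" using Cons.prems by (cases x; cases "fst x") auto
  from Cons.prems obtain r where r: "tangle (raise d) s r" "slice (Suc (Suc p), e) r t"
    by (auto simp: raise_def x)
  show ?case
  proof (cases "d = []")
    case True
    then show ?thesis using r by (auto simp: raise_def x simp del: slice_Suc_Suc) auto
  next
    case False
    then show ?thesis using Cons.IH[OF r(1)] Cons.prems r(2) by (auto simp: x)
  qed
qed simp

lemma refines_raise: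
  "refines d d' \<Longrightarrow> d \<noteq> [] \<Longrightarrow> \<forall>(p, e) \<in> set d. 1 \<le> p \<Longrightarrow> refines (raise d) (raise d')"
  unfolding refines_def by (metis tangle_raise tangle_raise_cases)

text \<open>Directed on purpose: the empty diagram fits wherever a cancelling pair of crossings
  does, but not conversely. Quantifying over the surrounding diagrams builds in compatibility with
  contexts.\<close>

definition deforms :: "diagram \<Rightarrow> diagram \<Rightarrow> bool"
  where "deforms m m' \<longleftrightarrow> (\<forall>d1 d2. link_diagram (d1 @ m @ d2) \<longrightarrow>
    link_diagram (d1 @ m' @ d2) \<and> same_link (d1 @ m @ d2) (d1 @ m' @ d2))"

lemma deforms_refl [simp, intro]: "deforms m m"
  by (simp add: deforms_def same_link_def)

lemma deforms_trans [trans]: "deforms m m' \<Longrightarrow> deforms m' m'' \<Longrightarrow> deforms m m''"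
  unfolding deforms_def same_link_def by (meson equivclp_trans)

lemma deforms_context: "deforms m m' \<Longrightarrow> deforms (a @ m @ b) (a @ m' @ b)"
  unfolding deforms_def by (metis append.assoc)

lemma deforms_append: "deforms m m' \<Longrightarrow> deforms (m @ b) (m' @ b)"
  and deforms_prepend: "deforms m m' \<Longrightarrow> deforms (a @ m) (a @ m')"
  using deforms_context[of m m' "[]" b] deforms_context[of m m' a "[]"] by simp_all

lemma deforms_Cons: "deforms m m' \<Longrightarrow> deforms (x # m) (x # m')"
  using deforms_prepend[of m m' "[x]"] by simp

lemma deformsI:
  assumes "move m m' \<or> move m' m" "refines m m'"
  shows "deforms m m'"
  unfolding deforms_def
proof (intro allI impI)
  fix d1 d2 assume *: "link_diagram (d1 @ m @ d2)"
  then have **: "link_diagram (d1 @ m' @ d2)"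
    using assms(2) by (auto simp: link_diagram_def tangle_append refines_def)
  have "diagram_step (d1 @ m @ d2) (d1 @ m' @ d2) \<or> diagram_step (d1 @ m' @ d2) (d1 @ m @ d2)"
    unfolding diagram_step_def using * ** assms(1) by blast
  then have "same_link (d1 @ m @ d2) (d1 @ m' @ d2)"
    unfolding same_link_def by (meson equivclp_sym r_into_equivclp)
  with ** show "link_diagram (d1 @ m' @ d2) \<and> same_link (d1 @ m @ d2) (d1 @ m' @ d2)" ..
qed

lemma refines_slide_cap:
  "refines [(Suc n, Cap), (Suc (Suc n), Cross s)] [(Suc (Suc n), Cap), (Suc n, Cross (\<not> s))]"
  "refines [(Suc (Suc n), Cap), (Suc n, Cross (\<not> s))] [(Suc n, Cap), (Suc (Suc n), Cross s)]"
proof (induction n)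
  case 0
  { case 1 show ?case by (auto simp: refines_def) }
  { case 2 show ?case by (auto simp: refines_def) }
next
  case (Suc n)
  { case 1 show ?case using refines_raise[OF Suc(1)] by (simp add: raise_def) }
  { case 2 show ?case using refines_raise[OF Suc(2)] by (simp add: raise_def) }
qed

lemma refines_slide_cup:
  "refines [(Suc (Suc n), Cross s), (Suc n, Cup a)] [(Suc n, Cross (\<not> s)), (Suc (Suc n), Cup a)]"
  "refines [(Suc n, Cross (\<not> s)), (Suc (Suc n), Cup a)] [(Suc (Suc n), Cross s), (Suc n, Cup a)]"
proof (induction n)
  case 0
  { case 1 show ?case by (auto simp: refines_def) }
  { case 2 show ?case by (auto simp: refines_def) }
next
  case (Suc n)
  { case 1 show ?case using refines_raise[OF Suc(1)] by (simp add: raise_def) }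
  { case 2 show ?case using refines_raise[OF Suc(2)] by (simp add: raise_def) }
qed

lemma refines_reduce:
  "refines [(Suc n, Cap), (Suc (Suc n), Cup a)] []"
  "refines [(Suc n, Cross s), (Suc n, Cup a)] [(Suc n, Cup (\<not> a))]"
  "refines [(Suc n, Cross s), (Suc n, Cross (\<not> s))] []"
  "refines [(Suc n, Cross s), (Suc (Suc n), Cross s), (Suc n, Cross s)]
    [(Suc (Suc n), Cross s), (Suc n, Cross s), (Suc (Suc n), Cross s)]"
proof (induction n)
  case 0
  { case 1 show ?case by (auto simp: refines_def) }
  { case 2 show ?case by (auto simp: refines_def) }
  { case 3 show ?case by (auto simp: refines_def) }
  { case 4 show ?case by (auto simp: refines_def) }
next
  case (Suc n)
  { case 1 show ?case using refines_raise[OF Suc(1)] by (simp add: raise_def) }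
  { case 2 show ?case using refines_raise[OF Suc(2)] by (simp add: raise_def) }
  { case 3 show ?case using refines_raise[OF Suc(3)] by (simp add: raise_def) }
  { case 4 show ?case using refines_raise[OF Suc(4)] by (simp add: raise_def) }
qed

text \<open>With the gap d between the two events as parameter, the change of position is expressed
  without truncated subtraction.\<close>

lemma refines_exchange:
  "refines [(n + d + 1 + ends_out e, e'), (Suc n, e)] [(Suc n, e), (n + d + 1 + ends_in e, e')]"
  "refines [(Suc n, e), (n + d + 1 + ends_in e, e')] [(n + d + 1 + ends_out e, e'), (Suc n, e)]"
proof (induction n)
  case 0
  { case 1 show ?case by (cases e) (auto simp: refines_def numeral_2_eq_2, blast) }
  { case 2 show ?case by (cases e) (auto simp: refines_def numeral_2_eq_2) }
next
  case (Suc n)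
  { case 1 show ?case using refines_raise[OF Suc(1)] by (simp add: raise_def) }
  { case 2 show ?case using refines_raise[OF Suc(2)] by (simp add: raise_def) }
qed

lemma deforms_exchange:
  assumes "1 \<le> p" "p + ends_in e \<le> p'" "r = p' + ends_out e - ends_in e"
  shows "deforms [(r, e'), (p, e)] [(p, e), (p', e')]"
    and "deforms [(p, e), (p', e')] [(r, e'), (p, e)]"
proof -
  obtain n where n: "p = Suc n" using assms(1) by (cases p) auto
  define d where "d = p' - ends_in e - p"
  have p': "p' = n + d + 1 + ends_in e" and r: "r = n + d + 1 + ends_out e"
    using assms by (auto simp: d_def n)
  have "move [(r, e'), (p, e)] [(p, e), (p', e')]"
    using exchange[OF assms(2)] assms(3) by simp
  then show "deforms [(r, e'), (p, e)] [(p, e), (p', e')]"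
      "deforms [(p, e), (p', e')] [(r, e'), (p, e)]"
    using refines_exchange[where n = n and d = d and e = e and e' = e'] by (auto intro!: deformsI simp: n p' r)
qed

lemma deforms_slide_cap:
  assumes "1 \<le> p"
  shows "deforms [(p, Cap), (p + 1, Cross s)] [(p + 1, Cap), (p, Cross (\<not> s))]"
    and "deforms [(p + 1, Cap), (p, Cross (\<not> s))] [(p, Cap), (p + 1, Cross s)]"
  using assms refines_slide_cap[of "p - 1"] slide_cap[of p s] by (auto intro!: deformsI)

lemma deforms_slide_cup:
  assumes "1 \<le> p"
  shows "deforms [(p + 1, Cross s), (p, Cup a)] [(p, Cross (\<not> s)), (p + 1, Cup a)]"
    and "deforms [(p, Cross (\<not> s)), (p + 1, Cup a)] [(p + 1, Cross s), (p, Cup a)]"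
  using assms refines_slide_cup[of "p - 1"] slide_cup[of p s a] by (auto intro!: deformsI)

lemma
  assumes "1 \<le> p"
  shows deforms_zigzag: "deforms [(p, Cap), (p + 1, Cup a)] []"
    and deforms_R1: "deforms [(p, Cross s), (p, Cup a)] [(p, Cup (\<not> a))]"
    and deforms_R2: "deforms [(p, Cross s), (p, Cross (\<not> s))] []"
    and deforms_R3: "deforms [(p, Cross s), (p + 1, Cross s), (p, Cross s)]
        [(p + 1, Cross s), (p, Cross s), (p + 1, Cross s)]"
  using assms refines_reduce[of "p - 1"] zigzag_left[of p a] R1_cup[of p s a] R2[of p s] R3[of p s]
  by (auto intro!: deformsI)

text \<open>A curl in the middle of a strand is not itself a listed move. Sliding the crossing
  across the maximum puts it onto the minimum, where Reidemeister I removes it and leaves a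
  zigzag.\<close>

lemma deforms_curl:
  assumes "1 \<le> p"
  shows "deforms [(p + 1, Cap), (p, Cross s), (p + 1, Cup a)] []"
proof -
  have "deforms [(p + 1, Cap), (p, Cross s), (p + 1, Cup a)]
      [(p, Cap), (p + 1, Cross (\<not> s)), (p + 1, Cup a)]"
    using deforms_append[OF deforms_slide_cap(2)[OF assms, of "\<not> s"], of "[(p + 1, Cup a)]"] by simp
  also have "deforms \<dots> [(p, Cap), (p + 1, Cup (\<not> a))]"
    by (intro deforms_Cons deforms_R1) simp
  also have "deforms \<dots> []"
    by (rule deforms_zigzag[OF assms])
  finally show ?thesis .
qed


section \<open>Braid closures\<close>

definition cups :: "nat \<Rightarrow> diagram"
  where "cups k = map (\<lambda>i. (i, Cup True)) (rev [1..<k+1])"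

definition caps :: "nat \<Rightarrow> diagram"
  where "caps k = map (\<lambda>i. (i, Cap)) [1..<k+1]"

definition crossings :: "braid \<Rightarrow> diagram"
  where "crossings b = map (\<lambda>(i, s). (i, Cross s)) b"

lemma cups_simps [simp]: "cups 0 = []" "cups (Suc k) = (Suc k, Cup True) # cups k"
  and caps_simps [simp]: "caps 0 = []" "caps (Suc k) = caps k @ [(Suc k, Cap)]"
  and crossings_simps [simp]: "crossings [] = []" "crossings ((i, s) # b) = (i, Cross s) # crossings b"
    "crossings (b @ c) = crossings b @ crossings c"
  by (simp_all add: cups_def caps_def crossings_def)

lemma braid_closure_eq: "braid_closure k b = caps k @ crossings b @ cups k"
  by (simp add: braid_closure_def caps_def cups_def crossings_def)

lemma tangle_cups: "tangle (cups k) [] (replicate k True @ replicate k False)"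
proof (induction k)
  case (Suc k)
  have "slice (length (replicate k True) + 1, Cup True) (replicate k True @ replicate k False)
      (replicate k True @ [True, \<not> True] @ replicate k False)"
    by (rule slice.intros)
  then show ?case using Suc by (auto simp: replicate_app_Cons_same)
qed simp

lemma tangle_caps: "tangle (caps k) (replicate k True @ replicate k False) []"
proof (induction k)
  case (Suc k)
  have "slice (length (replicate k True) + 1, Cap) (replicate k True @ [True, \<not> True] @ replicate k False)
      (replicate k True @ replicate k False)"
    by (rule slice.intros)
  then show ?case using Suc by (auto simp: replicate_app_Cons_same tangle_append)
qed simp

lemma replicate_split:
  assumes "1 \<le> i" "i < k"
  shows "replicate k x = replicate (i - 1) x @ [x, x] @ replicate (k - i - 1) x"
proof -
  have "k = (i - 1) + (2 + (k - i - 1))" using assms by simp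
  then have "replicate k x = replicate (i - 1) x @ replicate (2 + (k - i - 1)) x"
    by (metis replicate_add)
  then show ?thesis by (simp add: numeral_2_eq_2)
qed

lemma tangle_crossings:
  "is_braid k b \<Longrightarrow> tangle (crossings b) (replicate k True @ v) (replicate k True @ v)"
proof (induction b)
  case (Cons c b)
  obtain i s where c: "c = (i, s)" by (cases c)
  then have i: "1 \<le> i" "i < k" using Cons.prems by auto
  have "slice (length (replicate (i - 1) True) + 1, Cross s)
      (replicate (i - 1) True @ [True, True] @ (replicate (k - i - 1) True @ v))
      (replicate (i - 1) True @ [True, True] @ (replicate (k - i - 1) True @ v))"
    by (rule slice.intros)
  then have "slice (i, Cross s) (replicate k True @ v) (replicate k True @ v)"
    using i by (simp add: replicate_split[of i k])
  then show ?case using Cons by (auto simp: c)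
qed simp

lemma link_diagram_braid_closure: "is_braid k b \<Longrightarrow> link_diagram (braid_closure k b)"
  unfolding braid_closure_eq link_diagram_def tangle_append
  using tangle_cups tangle_caps tangle_crossings by blast

lemma deforms_crossings_commute:
  assumes "\<And>i s. (i, s) \<in> set b \<Longrightarrow> 1 \<le> i \<and> i + 2 \<le> p"
  shows "deforms ((p, e) # crossings b) (crossings b @ [(p, e)])"
    and "deforms (crossings b @ [(p, e)]) ((p, e) # crossings b)"
proof -
  have *: "deforms ((p, e) # crossings b) (crossings b @ [(p, e)]) \<and>
      deforms (crossings b @ [(p, e)]) ((p, e) # crossings b)"
    using assms
  proof (induction b)
    case (Cons c b)
    obtain i s where c: "c = (i, s)" by (cases c)
    then have i: "1 \<le> i" "i + 2 \<le> p" using Cons.prems[of i s] by auto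
    have IH: "deforms ((p, e) # crossings b) (crossings b @ [(p, e)])"
      "deforms (crossings b @ [(p, e)]) ((p, e) # crossings b)"
      using Cons by auto
    have "deforms ((p, e) # (i, Cross s) # crossings b) ((i, Cross s) # (p, e) # crossings b)"
      using deforms_append[OF deforms_exchange(1)[of i "Cross s" p p e], of "crossings b"] i by simp
    also have "deforms \<dots> ((i, Cross s) # crossings b @ [(p, e)])"
      by (intro deforms_Cons IH)
    finally have 1: "deforms ((p, e) # (i, Cross s) # crossings b) ((i, Cross s) # crossings b @ [(p, e)])" .
    have "deforms ((i, Cross s) # crossings b @ [(p, e)]) ((i, Cross s) # (p, e) # crossings b)"
      by (intro deforms_Cons IH)
    also have "deforms \<dots> ((p, e) # (i, Cross s) # crossings b)"
      using deforms_append[OF deforms_exchange(2)[of i "Cross s" p p e], of "crossings b"] i by simp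
    finally show ?case using 1 by (simp add: c)
  qed simp
  show "deforms ((p, e) # crossings b) (crossings b @ [(p, e)])"
    "deforms (crossings b @ [(p, e)]) ((p, e) # crossings b)"
    using * by blast+
qed

text \<open>Strand i turns round in its cup and comes up as strand 2k + 1 - i, so a crossing at i, i
  + 1 reappears at 2k - i. Its flag is unchanged since each of the two slides flips it once. Cups
  nested further inside are passed by exchanges.\<close>

lemma deforms_cups:
  assumes "1 \<le> i" "i < k"
  shows "deforms ((i, Cross s) # cups k) ((2 * k - i, Cross s) # cups k)"
  using assms
proof (induction k)
  case (Suc k)
  show ?case
  proof (cases "i < k")
    case True
    have "deforms ((i, Cross s) # (Suc k, Cup True) # cups k) ((Suc k, Cup True) # (i, Cross s) # cups k)"
      using deforms_append[OF deforms_exchange(2)[of i "Cross s" "Suc k" "Suc k" "Cup True"], of "cups k"]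
        Suc.prems True by simp
    also have "deforms \<dots> ((Suc k, Cup True) # (2 * k - i, Cross s) # cups k)"
      using Suc True by (intro deforms_Cons) simp
    also have "deforms \<dots> ((2 * Suc k - i, Cross s) # (Suc k, Cup True) # cups k)"
    proof -
      have "deforms [(Suc k, Cup True), (2 * k - i, Cross s)] [(2 * Suc k - i, Cross s), (Suc k, Cup True)]"
        using True by (intro deforms_exchange) auto
      from deforms_append[OF this, of "cups k"] show ?thesis by simp
    qed
    finally show ?thesis by simp
  next
    case False
    then have k: "k = i" using Suc.prems by simp
    then obtain j where j: "i = Suc j" using Suc.prems by (cases i) auto
    have "deforms [(i, Cross s), (i + 1, Cup True), (i, Cup True)]
        [(i + 1, Cross (\<not> s)), (i, Cup True), (i, Cup True)]"
      using deforms_append[OF deforms_slide_cup(2)[of i "\<not> s" True], of "[(i, Cup True)]"] Suc.prems by simp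
    \<comment> \<open>The first slide has made the two cups disjoint; their heights are exchanged to
      bring the other one next to the crossing.\<close>
    also have "deforms \<dots> [(i + 1, Cross (\<not> s)), (i + 2, Cup True), (i, Cup True)]"
      using Suc.prems by (intro deforms_Cons deforms_exchange) auto
    also have "deforms \<dots> [(i + 2, Cross s), (i + 1, Cup True), (i, Cup True)]"
      using deforms_append[OF deforms_slide_cup(2)[of "i + 1" s True], of "[(i, Cup True)]"] by simp
    finally show ?thesis
      by (auto dest: deforms_append[of _ _ "cups j"] simp: k j numeral_3_eq_3)
  qed
qed simp

lemma deforms_caps:
  assumes "1 \<le> i" "i < k"
  shows "deforms (caps k @ [(2 * k - i, Cross s)]) (caps k @ [(i, Cross s)])"
  using assms
proof (induction k)
  case (Suc k)
  show ?case
  proof (cases "i < k")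
    case True
    have "deforms (caps k @ [(Suc k, Cap), (2 * Suc k - i, Cross s)])
        (caps k @ [(2 * k - i, Cross s), (Suc k, Cap)])"
      using Suc.prems True by (intro deforms_prepend deforms_exchange) auto
    also have "deforms \<dots> (caps k @ [(i, Cross s), (Suc k, Cap)])"
      using deforms_append[OF Suc.IH, of "[(Suc k, Cap)]"] Suc.prems True by simp
    also have "deforms \<dots> (caps k @ [(Suc k, Cap), (i, Cross s)])"
      using Suc.prems True by (intro deforms_prepend deforms_exchange) auto
    finally show ?thesis by simp
  next
    case False
    then have k: "k = i" using Suc.prems by simp
    then obtain j where j: "i = Suc j" using Suc.prems by (cases i) auto
    have "deforms [(i, Cap), (i + 1, Cap), (i + 2, Cross s)] [(i, Cap), (i + 2, Cap), (i + 1, Cross (\<not> s))]"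
      using deforms_Cons[OF deforms_slide_cap(1)[of "i + 1" s]] by simp
    also have "deforms \<dots> [(i, Cap), (i, Cap), (i + 1, Cross (\<not> s))]"
      using deforms_append[OF deforms_exchange(2)[of i Cap "i + 2" i Cap], of "[(i + 1, Cross (\<not> s))]"]
        Suc.prems by simp
    also have "deforms \<dots> [(i, Cap), (i + 1, Cap), (i, Cross s)]"
      using deforms_Cons[OF deforms_slide_cap(1)[of i "\<not> s"]] Suc.prems by simp
    finally show ?thesis
      by (auto dest: deforms_prepend[of _ _ "caps j"] simp: k j numeral_3_eq_3)
  qed
qed simp

text \<open>The lowest crossing travels along the cups to the returning strands, up beside the
  braid, and along the caps to the top.\<close>

lemma deforms_conjugation:
  assumes "1 \<le> i" "i < k" "is_braid k b"
  shows "deforms (braid_closure k (b @ [(i, s)])) (braid_closure k ((i, s) # b))"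
proof -
  have "deforms (braid_closure k (b @ [(i, s)])) ((caps k @ crossings b) @ (2 * k - i, Cross s) # cups k)"
    using deforms_prepend[OF deforms_cups[OF assms(1,2), of s], of "caps k @ crossings b"] by (simp add: braid_closure_eq)
  also have "\<dots> = caps k @ (crossings b @ [(2 * k - i, Cross s)]) @ cups k"
    by simp
  also have "deforms \<dots> (caps k @ ((2 * k - i, Cross s) # crossings b) @ cups k)"
    using assms by (intro deforms_context deforms_crossings_commute) (auto simp: is_braid_def)
  also have "\<dots> = (caps k @ [(2 * k - i, Cross s)]) @ crossings b @ cups k"
    by simp
  also have "deforms \<dots> ((caps k @ [(i, Cross s)]) @ crossings b @ cups k)"
    by (intro deforms_append deforms_caps assms)
  finally show ?thesis by (simp add: braid_closure_eq)
qed

text \<open>The second Markov move: the innermost cap and cup are pulled to the only crossing on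
  strand k + 1 and form a curl with it.\<close>

lemma deforms_stabilization:
  assumes "1 \<le> k" "is_braid k a" "is_braid k b"
  shows "deforms (braid_closure (Suc k) (a @ (k, s) # b)) (braid_closure k (a @ b))"
proof -
  have *: "1 \<le> i \<and> i + 2 \<le> Suc k" if "(i, t) \<in> set a \<union> set b" for i t
    using assms that by (auto simp: is_braid_def)
  have "braid_closure (Suc k) (a @ (k, s) # b)
      = caps k @ ((Suc k, Cap) # crossings a) @ ((k, Cross s) # crossings b @ [(Suc k, Cup True)] @ cups k)"
    by (simp add: braid_closure_eq)
  also have "deforms \<dots>
      (caps k @ (crossings a @ [(Suc k, Cap)]) @ ((k, Cross s) # crossings b @ [(Suc k, Cup True)] @ cups k))"
    using * by (intro deforms_context deforms_crossings_commute) auto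
  also have "\<dots> = (caps k @ crossings a @ [(Suc k, Cap), (k, Cross s)]) @
      (crossings b @ [(Suc k, Cup True)]) @ cups k"
    by simp
  also have "deforms \<dots> ((caps k @ crossings a @ [(Suc k, Cap), (k, Cross s)]) @
      ((Suc k, Cup True) # crossings b) @ cups k)"
    using * by (intro deforms_context deforms_crossings_commute) auto
  also have "\<dots> = (caps k @ crossings a) @ [(k + 1, Cap), (k, Cross s), (k + 1, Cup True)] @
      (crossings b @ cups k)"
    by simp
  also have "deforms \<dots> ((caps k @ crossings a) @ [] @ (crossings b @ cups k))"
    by (intro deforms_context deforms_curl assms)
  finally show ?thesis by (simp add: braid_closure_eq)
qed


section \<open>The Alexander polynomial on braids\<close>

text \<open>The number of strands is an argument because one word has different closures on
  different numbers of strands.\<close>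

definition braid_value :: "(diagram \<Rightarrow> qfield) \<Rightarrow> nat \<Rightarrow> braid \<Rightarrow> qfield"
  where "braid_value \<Delta> k b = \<Delta> (braid_closure k b)"

lemma is_braid_inverse [simp]: "is_braid k (braid_inverse b) \<longleftrightarrow> is_braid k b"
  by (induction b) (auto simp: braid_inverse_def)

context
  fixes \<Delta> :: "diagram \<Rightarrow> qfield"
  assumes alexander: "alexander_polynomial \<Delta>"
begin

lemma alexander_deforms:
  assumes "deforms d d'" "link_diagram d"
  shows "\<Delta> d = \<Delta> d'"
proof -
  have "link_diagram d' \<and> same_link d d'"
    using assms(1)[unfolded deforms_def, rule_format, of "[]" "[]"] assms(2) by simp
  then show ?thesis
    using alexander assms(2) by (simp add: alexander_polynomial_def link_invariant_def)
qed

lemma braid_value_trivial: "braid_value \<Delta> 1 [] = 1"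
  using alexander by (simp add: braid_value_def braid_closure_def alexander_polynomial_def)

lemma braid_value_skein:
  assumes "is_braid k u" "is_braid k v" "1 \<le> i" "i < k"
  shows "braid_value \<Delta> k (u @ (i, True) # v) - braid_value \<Delta> k (u @ (i, False) # v)
    = (inverse q - q) * braid_value \<Delta> k (u @ v)"
proof -
  let ?l = "replicate (i - 1) True" and ?r = "replicate (k - i - 1) True @ replicate k False"
  have eq: "?l @ [True, True] @ ?r = replicate k True @ replicate k False"
    using replicate_split[OF assms(3,4), of True] by simp
  have "tangle (crossings v @ cups k) [] (?l @ [True, True] @ ?r)"
    unfolding eq tangle_append using tangle_cups tangle_crossings[OF assms(2)] by blast
  moreover have "tangle (caps k @ crossings u) (?l @ [True, True] @ ?r) []"
    unfolding eq tangle_append using tangle_caps tangle_crossings[OF assms(1)] by blast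
  moreover have "i = length ?l + 1"
    using assms by simp
  ultimately have "\<Delta> ((caps k @ crossings u) @ [(i, Cross True)] @ (crossings v @ cups k))
      - \<Delta> ((caps k @ crossings u) @ [(i, Cross False)] @ (crossings v @ cups k))
      = (inverse q - q) * \<Delta> ((caps k @ crossings u) @ (crossings v @ cups k))"
    using alexander unfolding alexander_polynomial_def by blast
  then show ?thesis
    by (simp add: braid_value_def braid_closure_eq)
qed

lemma braid_value_deforms:
  assumes "deforms (crossings w) (crossings w')" "is_braid k (u @ w @ v)"
  shows "braid_value \<Delta> k (u @ w @ v) = braid_value \<Delta> k (u @ w' @ v)"
  unfolding braid_value_def
  using deforms_context[OF assms(1), of "caps k @ crossings u" "crossings v @ cups k"]
  by (intro alexander_deforms link_diagram_braid_closure assms(2)) (simp add: braid_closure_eq)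

lemma braid_value_inverse:
  assumes "is_braid k u" "is_braid k v" "1 \<le> i" "i < k"
  shows "braid_value \<Delta> k (u @ (i, s) # (i, \<not> s) # v) = braid_value \<Delta> k (u @ v)"
  using braid_value_deforms[of "[(i, s), (i, \<not> s)]" "[]" k u v] deforms_R2[of i s] assms by simp

lemma braid_value_braid:
  assumes "is_braid k u" "is_braid k v" "1 \<le> i" "Suc i < k"
  shows "braid_value \<Delta> k (u @ (i, s) # (Suc i, s) # (i, s) # v)
    = braid_value \<Delta> k (u @ (Suc i, s) # (i, s) # (Suc i, s) # v)"
  using braid_value_deforms[of "[(i, s), (Suc i, s), (i, s)]" "[(Suc i, s), (i, s), (Suc i, s)]" k u v]
    deforms_R3[of i s] assms by simp

lemma braid_value_far:
  assumes "is_braid k u" "is_braid k v" "1 \<le> j" "Suc j < i" "i < k"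
  shows "braid_value \<Delta> k (u @ (i, s) # (j, t) # v) = braid_value \<Delta> k (u @ (j, t) # (i, s) # v)"
  using braid_value_deforms[of "[(i, s), (j, t)]" "[(j, t), (i, s)]" k u v]
    deforms_exchange(1)[of j "Cross t" i i "Cross s"] assms by simp

lemma braid_value_conjugation:
  assumes "is_braid k u" "is_braid k v"
  shows "braid_value \<Delta> k (u @ v) = braid_value \<Delta> k (v @ u)"
  using assms
proof (induction u arbitrary: v)
  case (Cons c u)
  obtain i s where c: "c = (i, s)" by (cases c)
  have "braid_value \<Delta> k ((u @ v) @ [(i, s)]) = braid_value \<Delta> k ((i, s) # u @ v)"
    unfolding braid_value_def using Cons.prems
    by (intro alexander_deforms deforms_conjugation link_diagram_braid_closure) (auto simp: c)
  then show ?case using Cons.IH[of "v @ [(i, s)]"] Cons.prems by (simp add: c)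
qed simp

lemma braid_value_stabilization:
  assumes "1 \<le> k" "is_braid k u" "is_braid k v"
  shows "braid_value \<Delta> (Suc k) (u @ (k, s) # v) = braid_value \<Delta> k (u @ v)"
  unfolding braid_value_def using assms
  by (intro alexander_deforms deforms_stabilization link_diagram_braid_closure)
    (auto intro: is_braid_mono)

lemma braid_value_split:
  assumes "1 \<le> k" "is_braid k u"
  shows "braid_value \<Delta> (Suc k) u = 0"
proof -
  have "(inverse q - q) * braid_value \<Delta> (Suc k) (u @ []) = 0"
    using braid_value_skein[of "Suc k" u "[]" k] braid_value_stabilization[OF assms, of "[]"]
      is_braid_mono[OF assms(2), of "Suc k"] assms(1) by simp
  then show ?thesis using q_minus_inverse_nonzero by auto
qed

lemma braid_value_cancel:
  assumes "is_braid k u" "is_braid k v" "is_braid k c"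
  shows "braid_value \<Delta> k (u @ c @ braid_inverse c @ v) = braid_value \<Delta> k (u @ v)"
  using assms
proof (induction c arbitrary: u v)
  case (Cons x c)
  obtain i s where x: "x = (i, s)" by (cases x)
  have "braid_value \<Delta> k (u @ (x # c) @ braid_inverse (x # c) @ v)
      = braid_value \<Delta> k ((u @ [(i, s)]) @ c @ braid_inverse c @ ((i, \<not> s) # v))"
    by (simp add: braid_inverse_def x)
  also have "\<dots> = braid_value \<Delta> k ((u @ [(i, s)]) @ ((i, \<not> s) # v))"
    using Cons.prems by (intro Cons.IH) (auto simp: x)
  also have "\<dots> = braid_value \<Delta> k (u @ v)"
    using Cons.prems braid_value_inverse[of k u v i s] by (simp add: x)
  finally show ?case .
qed (simp add: braid_inverse_def)

end


section \<open>Evaluation of closed braids\<close>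

context doubled_schur_zero
begin

text \<open>The weight at the level of the braid when only the arcs s, ..., k - 1 are present: a 1
  for each upward strand and -1 = \<beta> - 1 for each returning one. For s = 1 it is the weight of
  the full braid, for s = k that of the open strand at position 1.\<close>

definition arc_weight :: "nat \<Rightarrow> weight"
  where "arc_weight s = (\<lambda>i. if 1 \<le> i \<and> i \<le> k - s + 1 then 1
    else if k + s \<le> i \<and> i \<le> k + (k - 1) then - 1 else 0)"

definition nested_caps :: "nat \<Rightarrow> free_alg"
  where "nested_caps s = prod_list (map (D k) (rev [s..<k]))"

definition nested_cups :: "nat \<Rightarrow> free_alg"
  where "nested_cups s = prod_list (map (D_star k) [s..<k])"

lemma nested_arcs_step:
  assumes "s < k"
  shows "nested_caps s = nested_caps (Suc s) * D k s" "nested_cups s = D_star k s * nested_cups (Suc s)"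
  using assms by (simp_all add: nested_caps_def nested_cups_def upt_conv_Cons)

lemma leads_D_star:
  assumes "1 \<le> s" "s < k"
  shows "leads (D_star k s) \<nu> (transfer (k - s + 1) (k + s) \<nu>)"
proof -
  have "leads (Es [k-s+1..<k] * Es (rev [k+1..<k+s]) * E k) \<nu>
      (transfer (k - s + 1) k (transfer (k + 1) (k + s) (transfer k (Suc k) \<nu>)))"
    using assms
    by (intro leads_mult[OF leads_mult[OF leads_interval(1) leads_interval(2)] leads_E_transfer]) auto
  then show ?thesis by (simp add: D_star_def)
qed

lemma leads_nested_cups:
  assumes "1 \<le> s" "s \<le> k"
  shows "leads (nested_cups s) (arc_weight k) (arc_weight s)"
  using assms(2,1)
proof (induction s rule: inc_induct)
  case base
  then show ?case by (simp add: nested_cups_def leads_one)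
next
  case (step s)
  have "transfer (k - s + 1) (k + s) (arc_weight (Suc s)) = arc_weight s"
    using step.hyps step.prems by (auto simp: transfer_def arc_weight_def fun_eq_iff)
  then show ?case
    unfolding nested_arcs_step(2)[OF step.hyps(2)]
    using step leads_mult[OF leads_D_star[of s "arc_weight (Suc s)"]] by simp
qed

text \<open>As x does not involve the last strand, the innermost cap slides past it to its cup and
  forms a free circle.\<close>

lemma partial_closure_split:
  assumes "1 \<le> s" "s < k" "is_braid (k - s) x"
  shows "eqv (arc_weight k) (nested_caps s * braid_image x * nested_cups s) 0"
proof -
  have "eqv (arc_weight k) (nested_caps s * braid_image x * nested_cups s)
      (nested_caps (Suc s) * (braid_image x * D k s) * nested_cups s)"
    unfolding nested_arcs_step(1)[OF assms(2)]
    by (rule commutes_step[OF _ refl D_commutes[OF assms]])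
      (use leads_nested_cups assms in \<open>auto simp: mult.assoc nested_cups_def intro!: homogeneous_prod_list homogeneous_D_star\<close>)
  also have "eqv (arc_weight k) \<dots> (nested_caps (Suc s) * braid_image x * 0 * nested_cups (Suc s))"
    by (rule eqv_step[where x = "D k s * D_star k s", OF _ refl leads_nested_cups D_D_star])
      (use assms in \<open>auto simp: nested_arcs_step mult.assoc arc_weight_def\<close>)
  finally show ?thesis by simp
qed

text \<open>The innermost cap slides past x and the innermost cup past y, until they enclose the
  crossing alone.\<close>

lemma partial_closure_crossing:
  assumes "1 \<le> s" "s < k" "is_braid (k - s) x" "is_braid (k - s) y"
  shows "eqv (arc_weight k) (nested_caps s * braid_image (x @ (k - s, t) # y) * nested_cups s)
    (nested_caps (Suc s) * braid_image (x @ y) * nested_cups (Suc s))"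
proof -
  let ?c = "braid_image [(k - s, t)]"
  have hom: "homogeneous (nested_cups (Suc s))"
    by (auto simp: nested_cups_def intro!: homogeneous_prod_list homogeneous_D_star)
  have "braid_image (x @ (k - s, t) # y) = braid_image x * ?c * braid_image y"
    using braid_image_append[of x "[(k - s, t)] @ y"] braid_image_append[of "[(k - s, t)]" y]
    by (simp add: mult.assoc)
  then have "nested_caps s * braid_image (x @ (k - s, t) # y) * nested_cups s
      = nested_caps (Suc s) * (D k s * braid_image x) * (?c * braid_image y * D_star k s * nested_cups (Suc s))"
    by (simp add: nested_arcs_step[OF assms(2)] mult.assoc)
  also have "eqv (arc_weight k) \<dots>
      (nested_caps (Suc s) * (braid_image x * D k s) * (?c * braid_image y * D_star k s * nested_cups (Suc s)))"
    by (rule commutes_step[OF refl refl D_commutes])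
      (intro assms homogeneous_mult homogeneous_braid_image homogeneous_D_star hom)+
  also have "eqv (arc_weight k) \<dots>
      (nested_caps (Suc s) * braid_image x * D k s * ?c * (D_star k s * braid_image y) * nested_cups (Suc s))"
    by (rule commutes_step[OF _ refl commutes_sym[OF D_star_commutes] hom])
      (use assms in \<open>simp_all add: mult.assoc\<close>)
  also have "eqv (arc_weight k) \<dots>
      (nested_caps (Suc s) * braid_image x * 1 * (braid_image y * nested_cups (Suc s)))"
  proof (rule eqv_step[where x = "D k s * ?c * D_star k s", OF _ refl])
    show "leads (braid_image y * nested_cups (Suc s)) (arc_weight k) (arc_weight (Suc s))"
      using assms by (intro leads_mult[OF leads_braid_image] leads_nested_cups) auto
    show "eqv (arc_weight (Suc s)) (D k s * ?c * D_star k s) 1"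
      using assms by (intro D_crossing_D_star) (auto simp: arc_weight_def)
  qed (simp add: mult.assoc)
  finally show ?thesis by (simp add: braid_image_append mult.assoc)
qed

lemma partial_closure_eqv:
  assumes "eqv (arc_weight s) (braid_image w) (braid_image w')" "1 \<le> s" "s \<le> k"
  shows "eqv (arc_weight k) (nested_caps s * braid_image (u @ w @ v) * nested_cups s)
    (nested_caps s * braid_image (u @ w' @ v) * nested_cups s)"
  by (rule eqv_step[where u = "nested_caps s * braid_image u" and v = "braid_image v * nested_cups s",
        OF _ _ leads_mult[OF leads_braid_image leads_nested_cups] assms(1)])
    (use assms in \<open>auto simp: braid_image_append mult.assoc\<close>)

text \<open>An identity already in the free algebra: the images of the two crossings differ by a
  scalar.\<close>

lemma braid_image_skein:
  "braid_image (u @ (i, \<not> s) # v)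
    = braid_image (u @ (i, s) # v) + scalar (if s then q - inverse q else inverse q - q) * braid_image (u @ v)"
  by (simp add: braid_image_append braid_image_Cons scalar_simps algebra_simps
      scalar_left_commute[of "braid_image u"])

context
  fixes \<Delta> :: "diagram \<Rightarrow> qfield"
  assumes alexander: "alexander_polynomial \<Delta>"
begin

text \<open>On the algebra side the inverse and braid relations are available because
  \<open>arc_weight s\<close> is 1 at each of the positions 1, ..., k - s + 1, that is, on every
  strand of the braid.\<close>

lemma hecke_closed_partial_closure:
  assumes "1 \<le> s" "s < k"
  shows "hecke_closed (k - s + 1)
    (\<lambda>b. eqv (arc_weight k) (nested_caps s * braid_image b * nested_cups s) (scalar (braid_value \<Delta> (k - s + 1) b)))"
  (is "hecke_closed ?m ?P")
  unfolding hecke_closed_def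
proof (intro allI impI, elim conjE)
  fix u v :: braid and i :: nat and t :: bool
  assume *: "is_braid ?m u" "is_braid ?m v" "1 \<le> i" "i < ?m"
  have w: "arc_weight s i = 1" "arc_weight s (Suc i) = 1"
    and w': "Suc i < ?m \<Longrightarrow> arc_weight s (Suc (Suc i)) = 1" and i: "i < k" "Suc i < ?m \<Longrightarrow> Suc i < k"
    using * assms by (auto simp: arc_weight_def)
  have transport: "?P (u @ x @ v) \<Longrightarrow> ?P (u @ y @ v)"
    if "eqv (arc_weight s) (braid_image y) (braid_image x)"
      "braid_value \<Delta> ?m (u @ y @ v) = braid_value \<Delta> ?m (u @ x @ v)" for x y
    using eqv_trans[OF partial_closure_eqv[OF that(1)]] that(2) assms by simp
  have "?P (u @ (i, \<not> t) # v)" if "?P (u @ v)" "?P (u @ (i, t) # v)"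
  proof -
    let ?c = "if t then q - inverse q else inverse q - q"
    have "nested_caps s * braid_image (u @ (i, \<not> t) # v) * nested_cups s
        = nested_caps s * braid_image (u @ (i, t) # v) * nested_cups s
          + scalar ?c * (nested_caps s * braid_image (u @ v) * nested_cups s)"
      unfolding braid_image_skein
      by (simp add: distrib_left distrib_right mult.assoc scalar_left_commute[of "nested_caps s"])
    also have "eqv (arc_weight k) \<dots>
        (scalar (braid_value \<Delta> ?m (u @ (i, t) # v)) + scalar ?c * scalar (braid_value \<Delta> ?m (u @ v)))"
      by (intro eqv_add eqv_left that)
    also have "\<dots> = scalar (braid_value \<Delta> ?m (u @ (i, t) # v) + ?c * braid_value \<Delta> ?m (u @ v))"
      by (simp only: scalar_simps)
    also have "braid_value \<Delta> ?m (u @ (i, t) # v) + ?c * braid_value \<Delta> ?m (u @ v)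
        = braid_value \<Delta> ?m (u @ (i, \<not> t) # v)"
      using braid_value_skein[OF alexander *] by (cases t) (auto simp: algebra_simps)
    finally show ?thesis .
  qed
  moreover have "?P (u @ (i, t) # (i, \<not> t) # v)" if "?P (u @ v)"
    using transport[of "[(i, t), (i, \<not> t)]" "[]"] that braid_value_inverse[OF alexander *, of t]
      crossing_inverse[OF *(3) i(1) w, of t] by simp
  moreover have "?P (u @ (Suc i, True) # (i, True) # (Suc i, True) # v)"
    if "Suc i < ?m" "?P (u @ (i, True) # (Suc i, True) # (i, True) # v)"
    using transport[of "[(Suc i, True), (i, True), (Suc i, True)]" "[(i, True), (Suc i, True), (i, True)]"]
      that braid_value_braid[OF alexander *(1-3) that(1), of True]
      eqv_sym[OF crossing_braid_relation[OF *(3) i(2)[OF that(1)] w w'[OF that(1)]]] by simp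
  moreover have "?P (u @ (i, t) # (j, t') # v) \<longleftrightarrow> ?P (u @ (j, t') # (i, t) # v)"
    if "1 \<le> j" "Suc j < i" for j t'
  proof -
    have "commutes (braid_image [(i, t)]) (braid_image [(j, t')])"
      using that * i assms by (intro far_crossings_commute) auto
    then have "eqv (arc_weight s) (braid_image [(i, t), (j, t')]) (braid_image [(j, t'), (i, t)])"
      using braid_image_append[of "[(i, t)]" "[(j, t')]"] braid_image_append[of "[(j, t')]" "[(i, t)]"]
      unfolding commutes_def by simp
    then have "eqv (arc_weight s) (braid_image [(j, t'), (i, t)]) (braid_image [(i, t), (j, t')])"
      and "eqv (arc_weight s) (braid_image [(i, t), (j, t')]) (braid_image [(j, t'), (i, t)])"
      by (simp_all only: eqv_sym)
    from this[THEN transport] show ?thesis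
      using braid_value_far[OF alexander *(1,2) that *(4), of t t'] by auto
  qed
  ultimately show "(?P (u @ v) \<longrightarrow> ?P (u @ (i, t) # v) \<longrightarrow> ?P (u @ (i, \<not> t) # v)) \<and>
      (?P (u @ v) \<longrightarrow> ?P (u @ (i, t) # (i, \<not> t) # v)) \<and>
      (Suc i < ?m \<longrightarrow> ?P (u @ (i, True) # (Suc i, True) # (i, True) # v) \<longrightarrow>
        ?P (u @ (Suc i, True) # (i, True) # (Suc i, True) # v)) \<and>
      (\<forall>j t'. 1 \<le> j \<and> Suc j < i \<longrightarrow>
        ?P (u @ (i, t) # (j, t') # v) = ?P (u @ (j, t') # (i, t) # v))"
    by blast
qed

text \<open>Each induction step adds one arc and one strand; s = k leaves a single strand and the
  empty word. In the crossing case one arc disappears on both sides at once: by evaluation in the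
  algebra and by stabilization of the diagram.\<close>

lemma partial_closure_value:
  assumes "1 \<le> s" "s \<le> k" "is_braid (k - s + 1) b"
  shows "eqv (arc_weight k) (nested_caps s * braid_image b * nested_cups s)
    (scalar (braid_value \<Delta> (k - s + 1) b))"
  using assms(2,1,3)
proof (induction s arbitrary: b rule: inc_induct)
  case base
  then have "b = []" by (cases b) (auto simp: is_braid_def)
  then show ?case
    using braid_value_trivial[OF alexander] eqv_refl[of "arc_weight k" 1]
    by (simp add: nested_caps_def nested_cups_def scalar_simps)
next
  case (step s)
  let ?P = "\<lambda>b. eqv (arc_weight k) (nested_caps s * braid_image b * nested_cups s)
    (scalar (braid_value \<Delta> (k - s + 1) b))"
  have s: "1 \<le> s" "s < k" "k - Suc s + 1 = k - s" "1 \<le> k - s" "k - s + 1 = Suc (k - s)"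
    using step by auto
  show ?case
  proof (rule hecke_normal_form[of "k - s" ?P])
    show "hecke_closed (Suc (k - s)) ?P"
      using hecke_closed_partial_closure[OF s(1,2)] s(5) by simp
    show "is_braid (Suc (k - s)) b" using step s by simp
  next
    fix x assume "is_braid (k - s) x"
    then show "?P x"
      using partial_closure_split[OF s(1,2)] braid_value_split[OF alexander s(4)] s(5)
      by (simp add: scalar_simps)
  next
    fix x y assume xy: "is_braid (k - s) x" "is_braid (k - s) y"
    have "eqv (arc_weight k) (nested_caps s * braid_image (x @ (k - s, True) # y) * nested_cups s)
        (nested_caps (Suc s) * braid_image (x @ y) * nested_cups (Suc s))"
      by (rule partial_closure_crossing[OF s(1,2) xy])
    also have "eqv (arc_weight k) \<dots> (scalar (braid_value \<Delta> (k - Suc s + 1) (x @ y)))"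
      using xy s by (intro step.IH) auto
    also have "braid_value \<Delta> (k - Suc s + 1) (x @ y) = braid_value \<Delta> (k - s + 1) (x @ (k - s, True) # y)"
      unfolding s(3,5) by (rule braid_value_stabilization[OF alexander s(4) xy, symmetric])
    finally show "?P (x @ (k - s, True) # y)" .
  qed
qed

text \<open>Conjugation by \<open>to_position j\<close> is invisible to \<open>\<Delta>\<close>. E_1
  ... E_{j-1} carries the open strand from j to position 1, and once the middle is a scalar it
  cancels against F_{j-1} ... F_1.\<close>

lemma open_closure_value:
  assumes "1 \<le> k" "is_braid k b" "1 \<le> j" "j \<le> k"
  shows "eqv (open_weight 0 k j) (open_closure k j b) (scalar (braid_value \<Delta> k b))"
proof -
  let ?c = "to_position j" and ?\<nu> = "open_weight 0 k j"
  let ?b = "braid_inverse ?c @ b @ ?c"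
  have c: "is_braid k ?c"
    using assms by (auto simp: to_position_def is_braid_def)
  have "braid_value \<Delta> k ?b = braid_value \<Delta> k ((b @ ?c) @ braid_inverse ?c)"
    using assms c by (intro braid_value_conjugation[OF alexander]) simp_all
  also have "\<dots> = braid_value \<Delta> k b"
    using braid_value_cancel[OF alexander assms(2) _ c, of "[]"] by simp
  finally have conj: "braid_value \<Delta> k ?b = braid_value \<Delta> k b" .
  have "transfer 1 j ?\<nu> = arc_weight k"
    using assms by (auto simp: transfer_def open_weight_def arc_weight_def fun_eq_iff)
  then have "leads (Es [1..<j]) ?\<nu> (arc_weight k)"
    using leads_interval(1)[OF assms(3), of ?\<nu>] by simp
  moreover have "eqv (arc_weight k) (nested_caps 1 * braid_image ?b * nested_cups 1) (scalar (braid_value \<Delta> k b))"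
    using partial_closure_value[of 1 ?b] assms c conj by simp
  ultimately have "eqv ?\<nu> (open_closure k j b)
      (Fs (rev [1..<j]) * scalar (braid_value \<Delta> k b) * Es [1..<j])"
    by (intro eqv_step[OF _ refl]) (auto simp: open_closure_def nested_caps_def nested_cups_def mult.assoc)
  also have "\<dots> = scalar (braid_value \<Delta> k b) * (Fs (rev [1..<j]) * Es [1..<j])"
    by (simp add: mult.assoc scalar_left_commute)
  also have "eqv ?\<nu> \<dots> (scalar (braid_value \<Delta> k b) * 1)"
    using assms by (intro eqv_left Fs_Es_eqv_one) (auto simp: open_weight_def)
  finally show ?thesis by simp
qed

end

end

lemma (in doubled_schur) mor_eqI:
  assumes "eqv \<nu> x y"
  shows "mor \<beta> k l \<nu> x = mor \<beta> k l \<nu> y"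
proof -
  have "eqv \<nu> z x \<longleftrightarrow> eqv \<nu> z y" for z
    using assms eqv_trans eqv_sym by blast
  then show ?thesis by (simp add: mor_def eqv_def)
qed

theorem theorem4p5:
  fixes \<Delta> :: "diagram \<Rightarrow> qfield" and K :: diagram and b :: braid and k j :: nat
  assumes "alexander_polynomial \<Delta>"
    and "1 \<le> k" and "is_braid k b"
    and "link_diagram K" and "same_link (braid_closure k b) K"
    and "1 \<le> j" and "j \<le> k"
  shows "mor 0 k (k - 1) (open_weight 0 k j) (open_closure k j b)
           \<in> Hom 0 k (k - 1) (open_weight 0 k j) (open_weight 0 k j)
       \<and> mor 0 k (k - 1) (open_weight 0 k j) (open_closure k j b)
           = mor 0 k (k - 1) (open_weight 0 k j) (scalar (\<Delta> K))"
proof -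
  have "braid_value \<Delta> k b = \<Delta> K"
    using assms link_diagram_braid_closure[OF assms(3)]
    unfolding braid_value_def by (simp add: alexander_polynomial_def link_invariant_def)
  then have "mor 0 k (k - 1) (open_weight 0 k j) (open_closure k j b)
      = mor 0 k (k - 1) (open_weight 0 k j) (scalar (\<Delta> K))"
    using doubled_schur.mor_eqI[OF doubled_schur_zero.open_closure_value[OF assms(1,2,3,6,7)]] by simp
  \<comment> \<open>Membership in \<open>Hom\<close> is read off from the scalar representative,
    which is supported on the empty word.\<close>
  moreover have "\<forall>w \<in> Poly_Mapping.keys (scalar (\<Delta> K)). target w \<nu> = \<nu>" for \<nu>
    using leads_scalar by (simp add: leads_def)
  ultimately show ?thesis
    unfolding Hom_def by auto
qed

end
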